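(* Let $A$ be a Vidinli algebra over a field $\mathbb{F}$ of characteristic not $2$ with norm $q$, let $B$ be its bilinear form, and let $V=\{x\in A\mid q(x,1)=0\}$. Then the following assertions hold: (a) The multiplication algebra $\mathcal{M}(A)$ is contained in $\mathbb{F}\,\mathrm{id}+A\bigl(B(A,.)+B(.,A)\bigr)$. (b) The subspace $(\operatorname{rad}B)\bigl(B(A,.)+B(.,A)\bigr)$ is an ideal of $\mathcal{M}(A)$ whose square is trivial (zero). (c) If the dimension of $A$ is finite, then $A\bigl(B(A,.)+B(.,A)\bigr)$ equals the annihilator in $\operatorname{End}_{\mathbb{F}}(A)$ of $\operatorname{rad}B$, i.e. $\{\varphi\in\operatorname{End}_{\mathbb{F}}(A)\mid\varphi(\operatorname{rad}B)=0\}$. (d) If either $B$ is symmetric and $\dim A/\operatorname{rad}B\geq 3$, or $B$ is not symmetric, then $$\mathcal{M}(A)=\mathbb{F}\,\mathrm{id}+A\bigl(B(A,.)+B(.,A)\bigr).$$ (e) If $B$ is symmetric and $\dim A/\operatorname{rad}B=1$, then $$\mathcal{M}(A)=\mathbb{F}\,\mathrm{id}\oplus(\operatorname{rad}B)B(A,.)=\mathbb{F}\,\mathrm{id}\oplus(\operatorname{rad}B)B(1,.).$$ (f) If $B$ is symmetric and $\dim A/\operatorname{rad}B=2$, pick $x\in V$ with $A=\mathbb{F}1\oplus\mathbb{F}x\oplus\operatorname{rad}B$; then $$\mathcal{M}(A)=\bigl(\mathbb{F}\,\mathrm{id}+\mathbb{F}\sigma_{1,x}+\mathbb{F}\pi_x\bigr)\oplus(\operatorname{rad}B)B(A,.),$$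 where $\pi_x\colon A\to A$ is the projection onto $\mathbb{F}1\oplus\mathbb{F}x$, i.e. $\pi_x(1)=1$, $\pi_x(x)=x$ and $\pi_x(\operatorname{rad}B)=0$, while $\sigma_{1,x}=q(1,.)x-q(x,.)1$.
   Context: Algebras are not necessarily associative: an algebra over a field $\mathbb{F}$ is a vector space with a bilinear multiplication (of arbitrary dimension). Write $[x,y]=xy-yx$. For a quadratic form $q$, its polar form is denoted by the same letter: $q(x,y)=q(x+y)-q(x)-q(y)$. A conic algebra is a unital algebra $A$ (unity $1$) endowed with a quadratic form $q\colon A\to\mathbb{F}$, called the norm, such that $q(1)=1$ and $x^2-q(x,1)x+q(x)1=0$ for all $x\in A$. A Vidinli algebra is a conic algebra $A$ such that $[A,A]\subseteq\mathbb{F}1$. For a Vidinli algebra $A$ with norm $q$ over a field of characteristic not $2$, let $\omega\colon A\times A\to\mathbb{F}$ be the skew-symmetric bilinear form with $[x,y]=\omega(x,y)1$. The bilinear form of the Vidinli algebra is $B\colon A\times A\to\mathbb{F}$, $B(x,y)=\frac12\bigl(q(x,y)-\omega(x,y)\bigr)$, and $\operatorname{rad}B=\{x\in A\mid B(x,A)=0=B(A,x)\}$. Moreover $A=\mathbb{F}1\oplus V$. The multiplication algebra $\mathcal{M}(A)$ is the associative subalgebra of $\operatorname{End}_{\mathbb{F}}(A)$ generated by all left multiplications $L_x\colon y\mapsto xy$ and right multiplications $R_x\colon y\mapsto yx$, $x\in A$. For a vector space $W$, $w\in W$ and $f\in W^*$ (the dual space), $wf$ (also written $f(.)w$) denotes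 the linear map $u\mapsto f(u)w$. For subsets $X\subseteq W$, $Y\subseteq W^*$, $XY$ denotes the linear span of $\{wf\mid w\in X,\ f\in Y\}$ in $\operatorname{End}_{\mathbb{F}}(W)$. Here $B(A,.)=\{B(a,.)\mid a\in A\}$ and $B(.,A)=\{B(.,a)\mid a\in A\}$ are subspaces of $A^*$, and $B(A,.)+B(.,A)$ is their sum; $q(x,.)$ is the linear form $y\mapsto q(x,y)$. *)

theory Defs
  imports
    "HOL-Library.Extended_Nat"
    "HOL-Library.Function_Algebras"
    "HOL-Library.Set_Algebras"
    Complex_Main
begin

text \<open>
  Vector spaces are given by a scalar multiplication \<open>scale\<close> on a type of class
  \<^class>\<open>ab_group_add\<close>, as in the locale \<^locale>\<open>vector_space\<close>. Sums of functions are pointwise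
  and sums of sets are elementwise (\<open>U + W = {u + w | u \<in> U, w \<in> W}\<close>), by the library instances.
\<close>

section \<open>Linear algebra\<close>

definition direct_sum :: "'b::ab_group_add set \<Rightarrow> 'b set \<Rightarrow> 'b set \<Rightarrow> bool" where
  "direct_sum X U W \<longleftrightarrow> X = U + W \<and> U \<inter> W = {0}"

definition direct_sum3 :: "'b::ab_group_add set \<Rightarrow> 'b set \<Rightarrow> 'b set \<Rightarrow> 'b set \<Rightarrow> bool" where
  "direct_sum3 X U V W \<longleftrightarrow> direct_sum (U + V) U V \<and> direct_sum X (U + V) W"

definition line :: "('f::field \<Rightarrow> 'b::ab_group_add \<Rightarrow> 'b) \<Rightarrow> 'b \<Rightarrow> 'b set" where
  "line scale v = module.span scale {v}"

text \<open>\<open>S\<close> is a set of representatives, one for each element, of a basis of the quotient by the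
  subspace \<open>W\<close>: a linear combination of cosets vanishes iff that of the representatives is in \<open>W\<close>.\<close>

definition quotient_basis ::
    "('f::field \<Rightarrow> 'a::ab_group_add \<Rightarrow> 'a) \<Rightarrow> 'a set \<Rightarrow> 'a set \<Rightarrow> bool" where
  "quotient_basis scale W S \<longleftrightarrow>
     (\<forall>T u. finite T \<and> T \<subseteq> S \<and> (\<Sum>v\<in>T. scale (u v) v) \<in> W \<longrightarrow> (\<forall>v\<in>T. u v = 0)) \<and>
     module.span scale S + W = UNIV"

text \<open>Dimension of the quotient of the whole space by \<open>W\<close>. The library's \<open>dim\<close> would return \<open>0\<close>
  in infinite dimension; here the value is \<open>\<infinity>\<close>.\<close>

definition quotient_dim :: "('f::field \<Rightarrow> 'a::ab_group_add \<Rightarrow> 'a) \<Rightarrow> 'a set \<Rightarrow> enat" where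
  "quotient_dim scale W =
     (if \<exists>S. finite S \<and> quotient_basis scale W S
      then enat (card (SOME S. finite S \<and> quotient_basis scale W S)) else \<infinity>)"

text \<open>The projection onto \<open>U\<close> along \<open>W\<close>, meaningful if the space is the direct sum of \<open>U\<close> and
  \<open>W\<close>.\<close>

definition proj_along :: "'a::ab_group_add set \<Rightarrow> 'a set \<Rightarrow> 'a \<Rightarrow> 'a" where
  "proj_along U W a = (THE u. u \<in> U \<and> a - u \<in> W)"


section \<open>Endomorphisms\<close>

definition End_space :: "('f::field \<Rightarrow> 'a::ab_group_add \<Rightarrow> 'a) \<Rightarrow> ('a \<Rightarrow> 'a) set" where
  "End_space scale = {\<phi>. Vector_Spaces.linear scale scale \<phi>}"

definition fscale :: "('f::field \<Rightarrow> 'a::ab_group_add \<Rightarrow> 'a) \<Rightarrow> 'f \<Rightarrow> ('a \<Rightarrow> 'a) \<Rightarrow> ('a \<Rightarrow> 'a)" where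
  "fscale scale c \<phi> = (\<lambda>u. scale c (\<phi> u))"

lemma vector_space_fscale:
  assumes "vector_space scale"
  shows "vector_space (fscale scale)"
proof -
  interpret vector_space scale by fact
  show ?thesis
    by standard (simp_all add: fscale_def fun_eq_iff scale_right_distrib scale_left_distrib)
qed

definition rank1 :: "('f::field \<Rightarrow> 'a::ab_group_add \<Rightarrow> 'a) \<Rightarrow> 'a \<Rightarrow> ('a \<Rightarrow> 'f) \<Rightarrow> ('a \<Rightarrow> 'a)" where
  "rank1 scale w f = (\<lambda>u. scale (f u) w)"

definition rank1_span ::
    "('f::field \<Rightarrow> 'a::ab_group_add \<Rightarrow> 'a) \<Rightarrow> 'a set \<Rightarrow> ('a \<Rightarrow> 'f) set \<Rightarrow> ('a \<Rightarrow> 'a) set" where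
  "rank1_span scale X Y = module.span (fscale scale) {rank1 scale w f | w f. w \<in> X \<and> f \<in> Y}"

definition End_subalgebra ::
    "('f::field \<Rightarrow> 'a::ab_group_add \<Rightarrow> 'a) \<Rightarrow> ('a \<Rightarrow> 'a) set \<Rightarrow> bool" where
  "End_subalgebra scale M \<longleftrightarrow> M \<subseteq> End_space scale \<and> module.subspace (fscale scale) M \<and>
     (\<forall>\<phi>\<in>M. \<forall>\<psi>\<in>M. \<phi> \<circ> \<psi> \<in> M)"

text \<open>Two-sided ideals of an associative algebra \<open>M\<close> of endomorphisms.\<close>

definition End_ideal ::
    "('f::field \<Rightarrow> 'a::ab_group_add \<Rightarrow> 'a) \<Rightarrow> ('a \<Rightarrow> 'a) set \<Rightarrow> ('a \<Rightarrow> 'a) set \<Rightarrow> bool" where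
  "End_ideal scale M I \<longleftrightarrow> I \<subseteq> M \<and> module.subspace (fscale scale) I \<and>
     (\<forall>\<phi>\<in>M. \<forall>\<psi>\<in>I. \<phi> \<circ> \<psi> \<in> I \<and> \<psi> \<circ> \<phi> \<in> I)"


section \<open>Conic and Vidinli algebras\<close>

definition polar :: "('a::ab_group_add \<Rightarrow> 'f::field) \<Rightarrow> 'a \<Rightarrow> 'a \<Rightarrow> 'f" where
  "polar q x y = q (x + y) - q x - q y"

definition quadratic_form ::
    "('f::field \<Rightarrow> 'a::ab_group_add \<Rightarrow> 'a) \<Rightarrow> ('a \<Rightarrow> 'f) \<Rightarrow> bool" where
  "quadratic_form scale q \<longleftrightarrow> (\<forall>c x. q (scale c x) = c\<^sup>2 * q x) \<and>
     (\<forall>y. Vector_Spaces.linear scale (*) (\<lambda>x. polar q x y)) \<and>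
     (\<forall>x. Vector_Spaces.linear scale (*) (\<lambda>y. polar q x y))"

locale unital_algebra = vector_space scale
  for scale :: "'f::field \<Rightarrow> 'a::ab_group_add \<Rightarrow> 'a" +
  fixes mul :: "'a \<Rightarrow> 'a \<Rightarrow> 'a" and one :: 'a
  assumes linear_mul_left: "Vector_Spaces.linear scale scale (\<lambda>y. mul x y)"
    and linear_mul_right: "Vector_Spaces.linear scale scale (\<lambda>y. mul y x)"
    and one_mul: "mul one x = x"
    and mul_one: "mul x one = x"

locale conic_algebra = unital_algebra scale mul one
  for scale :: "'f::field \<Rightarrow> 'a::ab_group_add \<Rightarrow> 'a" and mul and one +
  fixes q :: "'a \<Rightarrow> 'f"
  assumes quadratic_form_norm: "quadratic_form scale q"
    and norm_one: "q one = 1"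
    and conic: "mul x x - scale (polar q x one) x + scale (q x) one = 0"

locale vidinli_algebra = conic_algebra +
  assumes commutator_scalar: "mul x y - mul y x \<in> range (\<lambda>c. scale c one)"

definition vidinli_omega ::
    "('f::field \<Rightarrow> 'a::ab_group_add \<Rightarrow> 'a) \<Rightarrow> ('a \<Rightarrow> 'a \<Rightarrow> 'a) \<Rightarrow> 'a \<Rightarrow> 'a \<Rightarrow> 'a \<Rightarrow> 'f" where
  "vidinli_omega scale mul one x y = (THE c. mul x y - mul y x = scale c one)"

definition vidinli_form ::
    "('f::field \<Rightarrow> 'a::ab_group_add \<Rightarrow> 'a) \<Rightarrow> ('a \<Rightarrow> 'a \<Rightarrow> 'a) \<Rightarrow> 'a \<Rightarrow> ('a \<Rightarrow> 'f) \<Rightarrow> 'a \<Rightarrow> 'a \<Rightarrow> 'f" where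
  "vidinli_form scale mul one q x y = (1 / 2) * (polar q x y - vidinli_omega scale mul one x y)"

definition form_radical :: "('a \<Rightarrow> 'a \<Rightarrow> 'f::zero) \<Rightarrow> 'a set" where
  "form_radical B = {x. \<forall>a. B x a = 0 \<and> B a x = 0}"

definition symmetric_form :: "('a \<Rightarrow> 'a \<Rightarrow> 'f) \<Rightarrow> bool" where
  "symmetric_form B \<longleftrightarrow> (\<forall>x y. B x y = B y x)"

definition mult_algebra ::
    "('f::field \<Rightarrow> 'a::ab_group_add \<Rightarrow> 'a) \<Rightarrow> ('a \<Rightarrow> 'a \<Rightarrow> 'a) \<Rightarrow> ('a \<Rightarrow> 'a) set" where
  "mult_algebra scale mul =
     End_subalgebra scale hull (range (\<lambda>x y. mul x y) \<union> range (\<lambda>x y. mul y x))"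

text \<open>Uniqueness of the scalar in the definition of \<open>vidinli_omega\<close>.\<close>

lemma (in vidinli_algebra) commutator_omega:
  "mul x y - mul y x = scale (vidinli_omega scale mul one x y) one"
proof -
  have "q 0 = 0"
    using quadratic_form_norm unfolding quadratic_form_def
    by (metis mult_zero_left scale_zero_left zero_power2)
  hence "one \<noteq> 0" using norm_one by auto
  hence "\<exists>!c. mul x y - mul y x = scale c one"
    using commutator_scalar[of x y] by auto
  thus ?thesis unfolding vidinli_omega_def by (rule theI')
qed

end

theory Submission
  imports Defs
begin

text \<open>
  The key is a formula for the product. Linearizing the conic identity and adding the commutator gives
  \<open>xy = B(1, x)y + B(1, y)x - B(x, y)1\<close>, where \<open>B(1, x) = B(x, 1) = q(x, 1)/2\<close> and \<open>B(1, 1) = 1\<close>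
  (\<open>form_algebra_vidinli_form\<close>). In the notation \<open>wf\<close> for \<open>u \<mapsto> f(u)w\<close> this says
  \<open>L\<^sub>x = B(1, x) id + x B(1, .) - 1 B(x, .)\<close> and the same for \<open>R\<^sub>x\<close> with \<open>B(., x)\<close> in place of
  \<open>B(x, .)\<close>. The rest is linear algebra with rank one maps, governed by
  \<open>(wf)(w'f') = f(w') wf'\<close>. Write \<open>W = B(A, .) + B(., A)\<close> and \<open>R = rad B\<close>.

  \<^item> By the product rule \<open>AW\<close> is closed under composition, so \<open>\<F> id + AW\<close> is an algebra; it
  contains all \<open>L\<^sub>x\<close> and \<open>R\<^sub>x\<close>. Since \<open>W\<close> kills \<open>R\<close>, one has \<open>AW \<cdot> RW = 0\<close>, and \<open>RW\<close> is an ideal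
  of square zero as soon as it lies in \<open>M(A)\<close>. It does: for \<open>r\<close> in \<open>R\<close>, \<open>L\<^sub>r = r B(1, .)\<close>, and
  composing \<open>w B(1, .)\<close> with multiplications yields all \<open>wf\<close> with \<open>f\<close> in \<open>W\<close>
  (\<open>rank1_in_mult_algebra\<close>).

  \<^item> In finite dimension \<open>R\<close> is the common kernel of finitely many elements of \<open>W\<close>, and a linear map
  vanishing on the common kernel of finitely many functionals is a sum of rank one maps built from them
  (\<open>in_rank1_span_if_vanishes_on_common_kernel\<close>).

  \<^item> If \<open>1 B(1, .)\<close> lies in \<open>M(A)\<close>, then composing with \<open>L\<^sub>w\<close> on the left and with multiplications
  on the right gives all of \<open>AW\<close> (\<open>mult_algebra_eqI\<close>). A nonzero commutator provides \<open>1 B(1, .)\<close>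
  (\<open>mult_algebra_not_symmetric\<close>), and so do two orthogonal nonisotropic vectors in \<open>V\<close> for symmetric
  \<open>B\<close> (\<open>mult_algebra_two_orthogonal\<close>).

  \<^item> For symmetric \<open>B\<close>, extend \<open>1\<close> by pairwise orthogonal nonisotropic vectors as long as they do not
  span \<open>A\<close> modulo \<open>R\<close>: this stops at one vector, at two, or reaches a third
  (\<open>symmetric_form_cases\<close>); uniqueness of the dimension of a quotient matches these cases with
  \<open>dim A/R\<close>. With one vector \<open>L\<^sub>z\<close> lies in \<open>\<F> id + R B(1, .)\<close>. With two vectors \<open>1\<close> and \<open>x\<close> every
  \<open>L\<^sub>z\<close> is a combination of \<open>id\<close>, \<open>L\<^sub>x\<close> and some \<open>r B(1, .)\<close>, and \<open>L\<^sub>x\<^sup>2\<close> is a nonzero multiple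
  of \<open>\<pi>\<^sub>x\<close> (\<open>mult_algebra_plane\<close>).
\<close>

section \<open>Linear algebra\<close>

subsection \<open>Spans of rank one maps\<close>

context vector_space
begin

interpretation E: vector_space "fscale scale"
  by (rule vector_space_fscale) (rule vector_space_axioms)

lemma rank1_in_span: "w \<in> X \<Longrightarrow> f \<in> Y \<Longrightarrow> rank1 scale w f \<in> rank1_span scale X Y"
  unfolding rank1_span_def by (rule E.span_base) blast

lemma rank1_span_least:
  assumes "E.subspace S" "\<And>w f. w \<in> X \<Longrightarrow> f \<in> Y \<Longrightarrow> rank1 scale w f \<in> S"
  shows "rank1_span scale X Y \<subseteq> S"
  unfolding rank1_span_def by (rule E.span_minimal) (use assms in auto)

lemma subspace_rank1_span: "E.subspace (rank1_span scale X Y)"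
  unfolding rank1_span_def by (rule E.subspace_span)

lemma subspace_line: "E.subspace (line (fscale scale) \<phi>)"
  unfolding line_def by (rule E.subspace_span)

lemma in_line_End: "\<phi> \<in> line (fscale scale) \<psi> \<longleftrightarrow> (\<exists>c. \<phi> = fscale scale c \<psi>)"
  unfolding line_def E.span_singleton by auto

lemma in_line: "x \<in> line scale v \<longleftrightarrow> (\<exists>c. x = scale c v)"
  unfolding line_def span_singleton by auto

lemma in_line_plus_line: "z \<in> line scale u + line scale v \<longleftrightarrow> (\<exists>a b. z = scale a u + scale b v)"
  by (auto elim!: set_plus_elim simp: in_line) (auto intro: set_plus_intro simp: in_line)

lemma subspace_plus: "subspace S \<Longrightarrow> subspace T \<Longrightarrow> subspace (S + T)"
proof -
  assume *: "subspace S" "subspace T"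
  have "S + T = {x + y |x y. x \<in> S \<and> y \<in> T}" by (auto simp: set_plus_def)
  then show "subspace (S + T)" using subspace_sums[OF *] by simp
qed

lemma End_subspace_plus: "E.subspace S \<Longrightarrow> E.subspace T \<Longrightarrow> E.subspace (S + T)"
  by (rule vector_space.subspace_plus[OF E.vector_space_axioms])

lemma End_add: "\<phi> \<in> End_space scale \<Longrightarrow> \<phi> (x + y) = \<phi> x + \<phi> y"
  and End_scale: "\<phi> \<in> End_space scale \<Longrightarrow> \<phi> (scale c x) = scale c (\<phi> x)"
  by (auto simp: End_space_def Vector_Spaces.linear_iff)

lemma End_diff: "\<phi> \<in> End_space scale \<Longrightarrow> \<phi> (x - y) = \<phi> x - \<phi> y"
  using End_add[of \<phi> "x - y" y] by simp

lemma End_spaceI: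
  "(\<And>x y. \<phi> (x + y) = \<phi> x + \<phi> y) \<Longrightarrow> (\<And>c x. \<phi> (scale c x) = scale c (\<phi> x)) \<Longrightarrow>
     \<phi> \<in> End_space scale"
  using vector_space_axioms by (auto simp: End_space_def Vector_Spaces.linear_iff)

lemma functional_add: "Vector_Spaces.linear scale (*) f \<Longrightarrow> f (x + y) = f x + f y"
  and functional_scale: "Vector_Spaces.linear scale (*) f \<Longrightarrow> f (scale c x) = c * f x"
  by (auto simp: Vector_Spaces.linear_iff)

lemma functional_diff: "Vector_Spaces.linear scale (*) f \<Longrightarrow> f (x - y) = f x - f y"
  using functional_add[of f "x - y" y] by simp

lemma functionalI:
  "(\<And>x y. f (x + y) = f x + f y) \<Longrightarrow> (\<And>c x. f (scale c x) = c * f x) \<Longrightarrow>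
     Vector_Spaces.linear scale (*) f"
  unfolding Vector_Spaces.linear_iff using vector_space_axioms
  by (auto intro!: vector_space.intro simp: algebra_simps)

lemma subspace_End_space: "E.subspace (End_space scale)"
  unfolding E.subspace_def
  by (auto intro!: End_spaceI simp: End_add End_scale fscale_def algebra_simps)

lemma End_subalgebra_End_space: "End_subalgebra scale (End_space scale)"
  unfolding End_subalgebra_def
  by (auto intro!: subspace_End_space intro: End_spaceI simp: End_add End_scale)

lemma rank1_in_End: "Vector_Spaces.linear scale (*) f \<Longrightarrow> rank1 scale w f \<in> End_space scale"
  by (rule End_spaceI)
    (auto simp: rank1_def functional_add functional_scale scale_left_distrib)

lemma rank1_span_in_End:
  "(\<And>f. f \<in> Y \<Longrightarrow> Vector_Spaces.linear scale (*) f) \<Longrightarrow> rank1_span scale X Y \<subseteq> End_space scale"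
  by (rule rank1_span_least[OF subspace_End_space]) (simp add: rank1_in_End)

lemma rank1_span_kernel:
  assumes "\<phi> \<in> rank1_span scale X Y" "\<And>f. f \<in> Y \<Longrightarrow> f z = 0"
  shows "\<phi> z = 0"
proof -
  have "rank1_span scale X Y \<subseteq> {\<phi>. \<phi> z = 0}"
    by (rule rank1_span_least) (auto simp: E.subspace_def fscale_def rank1_def assms(2))
  with assms(1) show ?thesis by blast
qed

lemma rank1_span_image:
  assumes "\<phi> \<in> rank1_span scale X Y" "subspace X"
  shows "\<phi> u \<in> X"
proof -
  have "rank1_span scale X Y \<subseteq> {\<phi>. \<phi> u \<in> X}"
    by (rule rank1_span_least)
      (use assms(2) in \<open>auto simp: E.subspace_def subspace_def fscale_def rank1_def\<close>)
  with assms(1) show ?thesis by blast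
qed

text \<open>The reason is \<open>(w f) \<circ> (w' f') = f(w') \<cdot> w f'\<close>.\<close>

lemma rank1_span_comp:
  assumes Y: "\<And>f. f \<in> Y \<Longrightarrow> Vector_Spaces.linear scale (*) f"
    and "\<phi> \<in> rank1_span scale X Y" "\<psi> \<in> rank1_span scale X' Y'"
  shows "\<phi> \<circ> \<psi> \<in> rank1_span scale X Y'"
proof -
  let ?S = "rank1_span scale X Y'"
  note S = subspace_rank1_span[of X Y', unfolded E.subspace_def]
  have step: "rank1_span scale X' Y' \<subseteq> {\<psi>. rank1 scale w f \<circ> \<psi> \<in> ?S}"
    if w: "w \<in> X" and f: "f \<in> Y" for w f
  proof (rule rank1_span_least)
    have "f 0 = 0" using functional_scale[OF Y[OF f], of 0 0] by simp
    then have "rank1 scale w f \<circ> (0 :: 'b \<Rightarrow> 'b) = 0"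
      "rank1 scale w f \<circ> (\<phi> + \<psi>) = (rank1 scale w f \<circ> \<phi>) + (rank1 scale w f \<circ> \<psi>)"
      "rank1 scale w f \<circ> fscale scale c \<phi> = fscale scale c (rank1 scale w f \<circ> \<phi>)"
      for c and \<phi> \<psi> :: "'b \<Rightarrow> 'b"
      using functional_scale[OF Y[OF f]] functional_add[OF Y[OF f]]
      by (auto simp: fun_eq_iff rank1_def fscale_def scale_left_distrib)
    then show "E.subspace {\<psi>. rank1 scale w f \<circ> \<psi> \<in> ?S}"
      using S unfolding E.subspace_def by auto
    fix w' f' assume "w' \<in> X'" "f' \<in> Y'"
    have "rank1 scale w f \<circ> rank1 scale w' f' = fscale scale (f w') (rank1 scale w f')"
      using functional_scale[OF Y[OF f]] by (auto simp: fun_eq_iff rank1_def fscale_def mult.commute)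
    then show "rank1 scale w' f' \<in> {\<psi>. rank1 scale w f \<circ> \<psi> \<in> ?S}"
      using S rank1_in_span[OF w \<open>f' \<in> Y'\<close>] by auto
  qed
  have "rank1_span scale X Y \<subseteq> {\<phi>. \<phi> \<circ> \<psi> \<in> ?S}"
  proof (rule rank1_span_least)
    have "(0 :: 'b \<Rightarrow> 'b) \<circ> \<psi> = 0" "(\<phi> + \<phi>') \<circ> \<psi> = (\<phi> \<circ> \<psi>) + (\<phi>' \<circ> \<psi>)"
      "fscale scale c \<phi> \<circ> \<psi> = fscale scale c (\<phi> \<circ> \<psi>)" for c and \<phi> \<phi>' :: "'b \<Rightarrow> 'b"
      by (auto simp: fun_eq_iff fscale_def)
    then show "E.subspace {\<phi>. \<phi> \<circ> \<psi> \<in> ?S}"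
      using S unfolding E.subspace_def by auto
  qed (use step assms(3) in blast)
  with assms(2) show ?thesis by blast
qed

lemma rank1_span_comp_0:
  assumes "subspace X'" "\<And>f z. f \<in> Y \<Longrightarrow> z \<in> X' \<Longrightarrow> f z = 0"
    and "\<phi> \<in> rank1_span scale X Y" "\<psi> \<in> rank1_span scale X' Y'"
  shows "\<phi> \<circ> \<psi> = 0"
  using rank1_span_kernel[OF assms(3)] rank1_span_image[OF assms(4,1)] assms(2)
  by (auto simp: fun_eq_iff)

text \<open>A linear map factors through finitely many functionals as soon as it vanishes on their common
  kernel. In the induction, either the new functional \<open>f\<close> already vanishes on the common kernel of
  the others, or it takes a nonzero value there at some \<open>z\<close>, and then subtracting the rank one map
  \<open>\<phi>(z)/f(z) \<cdot> f\<close> makes \<open>\<phi>\<close> vanish on that larger kernel.\<close>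

lemma in_rank1_span_if_vanishes_on_common_kernel:
  assumes "finite F" "\<And>f. f \<in> F \<Longrightarrow> Vector_Spaces.linear scale (*) f"
    "\<phi> \<in> End_space scale" "\<And>z. (\<And>f. f \<in> F \<Longrightarrow> f z = 0) \<Longrightarrow> \<phi> z = 0"
  shows "\<phi> \<in> rank1_span scale UNIV F"
  using assms
proof (induction F arbitrary: \<phi>)
  case empty
  then have "\<phi> = 0" by (auto simp: fun_eq_iff)
  then show ?case using E.subspace_0[OF subspace_rank1_span] by blast
next
  case (insert f F)
  have mono: "rank1_span scale UNIV F \<subseteq> rank1_span scale UNIV (insert f F)"
    by (rule rank1_span_least[OF subspace_rank1_span]) (auto intro: rank1_in_span)
  show ?case
  proof (cases "\<exists>z. f z \<noteq> 0 \<and> (\<forall>g\<in>F. g z = 0)")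
    case False
    then have "\<phi> \<in> rank1_span scale UNIV F"
      using insert by (metis insert_iff)
    then show ?thesis using mono by blast
  next
    case True
    then obtain z where z: "f z \<noteq> 0" "\<And>g. g \<in> F \<Longrightarrow> g z = 0" by blast
    have f: "Vector_Spaces.linear scale (*) f" using insert by auto
    let ?r = "rank1 scale (scale (1 / f z) (\<phi> z)) f"
    have sub: "\<phi> - ?r \<in> End_space scale"
      using subspace_End_space E.subspace_diff rank1_in_End[OF f] insert.prems(2) by blast
    have "\<phi> - ?r \<in> rank1_span scale UNIV F"
    proof (rule insert.IH)
      show "\<phi> - ?r \<in> End_space scale" by (fact sub)
      fix y assume y: "\<And>g. g \<in> F \<Longrightarrow> g y = 0"
      let ?y = "y - scale (f y / f z) z"
      have "g ?y = 0" if g: "g \<in> insert f F" for g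
      proof (cases "g = f")
        case True
        with z(1) f show ?thesis by (simp add: functional_diff functional_scale)
      next
        case False
        with g have "g z = 0" "g y = 0" using z(2) y by blast+
        with insert.prems(1)[OF g] show ?thesis by (simp add: functional_diff functional_scale)
      qed
      then have "\<phi> ?y = 0" by (rule insert.prems(3))
      then show "(\<phi> - ?r) y = 0"
        using insert.prems(2) by (simp add: End_diff End_scale rank1_def)
    next
      show "Vector_Spaces.linear scale (*) g" if "g \<in> F" for g
        using that insert.prems(1) by blast
    qed
    moreover have "?r \<in> rank1_span scale UNIV (insert f F)"
      by (rule rank1_in_span) auto
    ultimately have "(\<phi> - ?r) + ?r \<in> rank1_span scale UNIV (insert f F)"
      using E.subspace_add[OF subspace_rank1_span] mono by blast
    then show ?thesis by simp
  qed
qed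

lemma End_subalgebra_plus:
  assumes D: "End_subalgebra scale D" and I: "End_subalgebra scale I"
    and comp: "\<And>\<phi> \<psi>. \<phi> \<in> D \<Longrightarrow> \<psi> \<in> I \<Longrightarrow> \<phi> \<circ> \<psi> \<in> I" "\<And>\<phi> \<psi>. \<phi> \<in> D \<Longrightarrow> \<psi> \<in> I \<Longrightarrow> \<psi> \<circ> \<phi> \<in> I"
  shows "End_subalgebra scale (D + I)"
  unfolding End_subalgebra_def
proof (intro conjI ballI)
  have sub: "D \<subseteq> End_space scale" "I \<subseteq> End_space scale" "E.subspace D" "E.subspace I"
    using D I by (auto simp: End_subalgebra_def)
  show "D + I \<subseteq> End_space scale"
    using sub E.subspace_add[OF subspace_End_space] by (auto elim!: set_plus_elim)
  show "E.subspace (D + I)" using sub End_subspace_plus by blast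
  fix \<phi> \<psi> assume "\<phi> \<in> D + I" "\<psi> \<in> D + I"
  then obtain d i d' i' where eq: "\<phi> = d + i" "\<psi> = d' + i'"
    and mem: "d \<in> D" "i \<in> I" "d' \<in> D" "i' \<in> I"
    by (auto elim!: set_plus_elim)
  have "\<phi> \<circ> \<psi> = (d \<circ> d') + ((d \<circ> i') + ((i \<circ> d') + (i \<circ> i')))"
    using mem sub by (auto simp: eq fun_eq_iff End_add subset_iff)
  moreover have "d \<circ> d' \<in> D" "i \<circ> i' \<in> I"
    using D I mem by (auto simp: End_subalgebra_def)
  ultimately show "\<phi> \<circ> \<psi> \<in> D + I"
    using comp mem E.subspace_add[OF sub(4)] by (metis set_plus_intro)
qed

lemma End_subalgebra_line_id: "End_subalgebra scale (line (fscale scale) id)"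
  unfolding End_subalgebra_def
proof (intro conjI ballI)
  show "line (fscale scale) id \<subseteq> End_space scale"
    by (auto simp: in_line_End fscale_def intro!: End_spaceI simp: algebra_simps)
  show "\<phi> \<circ> \<psi> \<in> line (fscale scale) id"
    if "\<phi> \<in> line (fscale scale) id" "\<psi> \<in> line (fscale scale) id" for \<phi> \<psi>
    using that by (auto simp: in_line_End fscale_def fun_eq_iff)
qed (rule subspace_line)

lemma End_subalgebra_rank1_span:
  assumes "\<And>f. f \<in> Y \<Longrightarrow> Vector_Spaces.linear scale (*) f"
  shows "End_subalgebra scale (rank1_span scale X Y)"
  unfolding End_subalgebra_def
proof (intro conjI ballI)
  show "rank1_span scale X Y \<subseteq> End_space scale"
    by (rule rank1_span_in_End) (rule assms)
  show "\<phi> \<circ> \<psi> \<in> rank1_span scale X Y"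
    if "\<phi> \<in> rank1_span scale X Y" "\<psi> \<in> rank1_span scale X Y" for \<phi> \<psi>
    by (rule rank1_span_comp[OF assms that])
qed (rule subspace_rank1_span)

lemma End_subalgebra_line_id_plus:
  assumes I: "End_subalgebra scale I"
  shows "End_subalgebra scale (line (fscale scale) id + I)"
proof (rule End_subalgebra_plus[OF End_subalgebra_line_id I])
  fix \<phi> \<psi> assume "\<phi> \<in> line (fscale scale) id" "\<psi> \<in> I"
  then obtain c where c: "\<phi> = fscale scale c id" by (auto simp: in_line_End)
  have I': "I \<subseteq> End_space scale" "E.subspace I"
    using I by (auto simp: End_subalgebra_def)
  have "\<phi> \<circ> \<psi> = fscale scale c \<psi>" "\<psi> \<circ> \<phi> = fscale scale c \<psi>"
    using I'(1) \<open>\<psi> \<in> I\<close> by (auto simp: c fscale_def fun_eq_iff End_scale subset_iff)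
  then show "\<phi> \<circ> \<psi> \<in> I" "\<psi> \<circ> \<phi> \<in> I"
    using E.subspace_scale[OF I'(2) \<open>\<psi> \<in> I\<close>] by auto
qed


subsection \<open>Dimensions of quotients\<close>

text \<open>Sending each element of \<open>T\<close> to a representative in \<open>span S\<close> is injective and keeps linear
  independence, which reduces the claim to the exchange lemma in \<open>span S\<close>.\<close>

lemma card_le_card_spanning_mod:
  assumes W: "subspace W" and S: "finite S" "span S + W = UNIV"
    and T: "finite T" "\<And>u. (\<Sum>v\<in>T. scale (u v) v) \<in> W \<Longrightarrow> \<forall>v\<in>T. u v = 0"
  shows "card T \<le> card S"
proof -
  have "\<exists>p. p \<in> span S \<and> v - p \<in> W" for v
  proof -
    have "v \<in> span S + W" using S by simp
    then show ?thesis by (auto elim!: set_plus_elim)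
  qed
  then obtain p where p: "\<And>v. p v \<in> span S" "\<And>v. v - p v \<in> W" by metis
  have indep: "\<forall>v\<in>T. u v = 0" if "(\<Sum>v\<in>T. scale (u v) (p v)) = 0" for u
  proof (rule T(2))
    have "(\<Sum>v\<in>T. scale (u v) v) = (\<Sum>v\<in>T. scale (u v) (v - p v))"
      using that by (simp add: scale_right_diff_distrib sum_subtractf)
    also have "\<dots> \<in> W" using p(2) W by (auto intro!: subspace_sum subspace_scale)
    finally show "(\<Sum>v\<in>T. scale (u v) v) \<in> W" .
  qed
  have inj: "inj_on p T"
  proof (rule inj_onI, rule ccontr)
    fix v w assume vw: "v \<in> T" "w \<in> T" "p v = p w" "v \<noteq> w"
    let ?u = "\<lambda>z. if z = v then 1 else if z = w then - 1 else 0 :: 'a"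
    have "(\<Sum>z\<in>T. scale (?u z) (p z)) = (\<Sum>z\<in>{v, w}. scale (?u z) (p z))"
      using vw T(1) by (intro sum.mono_neutral_right) auto
    also have "\<dots> = 0" using vw by simp
    finally show False using indep[of ?u] vw by auto
  qed
  have "independent (p ` T)"
  proof
    assume "dependent (p ` T)"
    then obtain u where u: "\<exists>v\<in>p ` T. u v \<noteq> 0" "(\<Sum>v\<in>p ` T. scale (u v) v) = 0"
      using dependent_finite[of "p ` T"] T(1) by auto
    have "(\<Sum>v\<in>T. scale (u (p v)) (p v)) = 0"
      using u(2) inj by (simp add: sum.reindex)
    then show False using indep[of "\<lambda>v. u (p v)"] u(1) by auto
  qed
  then have "card (p ` T) \<le> card S"
    using independent_span_bound[OF S(1), of "p ` T"] p(1) by auto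
  then show ?thesis using inj by (simp add: card_image)
qed

lemma quotient_dim_finite:
  assumes "finite S" "quotient_basis scale W S"
  obtains S' where "finite S'" "quotient_basis scale W S'" "quotient_dim scale W = enat (card S')"
proof -
  let ?P = "\<lambda>S. finite S \<and> quotient_basis scale W S"
  have "?P (SOME S. ?P S)" using assms by (intro someI[of ?P S]) auto
  moreover have "quotient_dim scale W = enat (card (SOME S. ?P S))"
    using assms by (auto simp: quotient_dim_def)
  ultimately show thesis using that by blast
qed

lemma quotient_dim_ge:
  assumes W: "subspace W"
    and T: "finite T" "\<And>u. (\<Sum>v\<in>T. scale (u v) v) \<in> W \<Longrightarrow> \<forall>v\<in>T. u v = 0"
  shows "enat (card T) \<le> quotient_dim scale W"
proof (cases "\<exists>S. finite S \<and> quotient_basis scale W S")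
  case True
  then obtain S where S: "finite S" "quotient_basis scale W S"
    "quotient_dim scale W = enat (card S)"
    using quotient_dim_finite by metis
  then have "span S + W = UNIV" by (simp add: quotient_basis_def)
  then have "card T \<le> card S"
    using card_le_card_spanning_mod[OF W S(1) _ T] by blast
  then show ?thesis using S(3) by simp
next
  case False
  then have "quotient_dim scale W = \<infinity>" unfolding quotient_dim_def by (rule if_not_P)
  then show ?thesis by simp
qed

lemma quotient_dim_eqI:
  assumes W: "subspace W" and T: "finite T" "span T + W = UNIV"
    and indep: "\<And>u. (\<Sum>v\<in>T. scale (u v) v) \<in> W \<Longrightarrow> \<forall>v\<in>T. u v = 0"
  shows "quotient_dim scale W = enat (card T)"
proof -
  have "quotient_basis scale W T"
    unfolding quotient_basis_def
  proof (intro conjI allI impI)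
    fix T' u assume T': "finite T' \<and> T' \<subseteq> T \<and> (\<Sum>v\<in>T'. scale (u v) v) \<in> W"
    let ?u = "\<lambda>v. if v \<in> T' then u v else 0"
    have "(\<Sum>v\<in>T. scale (?u v) v) = (\<Sum>v\<in>T'. scale (?u v) v)"
      using T' T(1) by (intro sum.mono_neutral_right) auto
    also have "\<dots> = (\<Sum>v\<in>T'. scale (u v) v)" by (intro sum.cong) auto
    finally have "\<forall>v\<in>T. ?u v = 0" using T' by (intro indep) simp
    then show "\<forall>v\<in>T'. u v = 0" using T' by (metis subsetD)
  qed (fact T)
  then obtain S where S: "finite S" "quotient_basis scale W S"
    "quotient_dim scale W = enat (card S)"
    using quotient_dim_finite T(1) by metis
  then have "card S \<le> card T"
    by (intro card_le_card_spanning_mod[OF W T]) (auto simp: quotient_basis_def)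
  then show ?thesis
    using S(3) quotient_dim_ge[OF W T(1) indep] by simp
qed

end


section \<open>The multiplication algebra of an algebra given by a bilinear form\<close>

text \<open>In characteristic not two, a Vidinli algebra is an algebra of this kind for its bilinear form.
  The locale forgets the norm, since left and right multiplications are determined by \<open>B\<close>.\<close>

locale form_algebra = vector_space scale
  for scale :: "'f::field \<Rightarrow> 'a::ab_group_add \<Rightarrow> 'a" +
  fixes B :: "'a \<Rightarrow> 'a \<Rightarrow> 'f" and mul :: "'a \<Rightarrow> 'a \<Rightarrow> 'a" and one :: 'a
  assumes B_add_left: "B (x + x') y = B x y + B x' y"
    and B_scale_left: "B (scale c x) y = c * B x y"
    and B_add_right: "B x (y + y') = B x y + B x y'"
    and B_scale_right: "B x (scale c y) = c * B x y"
    and B_one_right: "B x one = B one x"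
    and B_one_one: "B one one = 1"
    and mul_eq: "mul x y = scale (B one x) y + scale (B one y) x - scale (B x y) one"
begin

interpretation E: vector_space "fscale scale"
  by (rule vector_space_fscale) (rule vector_space_axioms)

abbreviation M :: "('a \<Rightarrow> 'a) set" where "M \<equiv> mult_algebra scale mul"

abbreviation R :: "'a set" where "R \<equiv> form_radical B"

abbreviation W :: "('a \<Rightarrow> 'f) set" where "W \<equiv> range (\<lambda>a. B a) + range (\<lambda>a y. B y a)"

lemma B_zero_left: "B 0 y = 0" and B_zero_right: "B x 0 = 0"
  using B_scale_left[of 0 0 y] B_scale_right[of x 0 0] by auto

lemma B_diff_left: "B (x - x') y = B x y - B x' y"
  using B_add_left[of "x - x'" x' y] by simp

lemma B_diff_right: "B x (y - y') = B x y - B x y'"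
  using B_add_right[of x "y - y'" y'] by simp

lemmas B_simps = B_zero_left B_zero_right B_diff_left B_diff_right B_add_left B_add_right
  B_scale_left B_scale_right B_one_one

lemma B_linear_right: "Vector_Spaces.linear scale (*) (B a)"
  by (rule functionalI; simp add: B_simps)

lemma W_linear:
  assumes "f \<in> W"
  shows "Vector_Spaces.linear scale (*) f"
  using assms by (intro functionalI) (auto elim!: set_plus_elim simp: B_simps algebra_simps)

lemma B_left_in_W: "B a \<in> W"
proof -
  have "B a + (\<lambda>y. B y 0) \<in> W" by (rule set_plus_intro) auto
  moreover have "B a + (\<lambda>y. B y 0) = B a" by (simp add: fun_eq_iff B_simps)
  ultimately show ?thesis by simp
qed

lemma B_right_in_W: "(\<lambda>y. B y a) \<in> W"
proof -
  have "B 0 + (\<lambda>y. B y a) \<in> W" by (rule set_plus_intro) auto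
  moreover have "B 0 + (\<lambda>y. B y a) = (\<lambda>y. B y a)" by (simp add: fun_eq_iff B_simps)
  ultimately show ?thesis by simp
qed

lemma W_radical: "f \<in> W \<Longrightarrow> r \<in> R \<Longrightarrow> f r = 0"
  by (auto elim!: set_plus_elim simp: form_radical_def)

lemma subspace_R: "subspace R"
  by (auto simp: subspace_def form_radical_def B_simps)

lemma rank1_span_W_least:
  assumes "E.subspace S"
    and "\<And>w a. w \<in> X \<Longrightarrow> rank1 scale w (B a) \<in> S"
    and "\<And>w a. w \<in> X \<Longrightarrow> rank1 scale w (\<lambda>y. B y a) \<in> S"
  shows "rank1_span scale X W \<subseteq> S"
proof (rule rank1_span_least[OF assms(1)])
  fix w f assume w: "w \<in> X" and "f \<in> W"
  then obtain a b where f: "f = B a + (\<lambda>y. B y b)" by (auto elim!: set_plus_elim)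
  have "rank1 scale w f = rank1 scale w (B a) + rank1 scale w (\<lambda>y. B y b)"
    by (simp add: f rank1_def fun_eq_iff scale_left_distrib)
  then show "rank1 scale w f \<in> S"
    using assms w E.subspace_add by metis
qed

lemma W_symmetric:
  assumes "symmetric_form B"
  shows "W = range (\<lambda>a. B a)"
proof
  have sym: "(\<lambda>y. B y b) = B b" for b
    using assms by (auto simp: symmetric_form_def)
  have sum: "B a + B b = B (a + b)" for a b
    by (simp add: fun_eq_iff B_simps)
  show "W \<subseteq> range (\<lambda>a. B a)"
    by (auto elim!: set_plus_elim simp: sym sum)
  show "range (\<lambda>a. B a) \<subseteq> W" using B_left_in_W by blast
qed

lemma left_mult_eq:
  "(\<lambda>y. mul x y) = fscale scale (B one x) id + (rank1 scale x (B one) - rank1 scale one (B x))"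
  by (simp add: fun_eq_iff mul_eq fscale_def rank1_def)

lemma right_mult_eq:
  "(\<lambda>y. mul y x) =
     fscale scale (B one x) id + (rank1 scale x (B one) - rank1 scale one (\<lambda>y. B y x))"
  by (simp add: fun_eq_iff mul_eq fscale_def rank1_def add.commute)

lemma rank1_in_rank1_span_W:
  assumes "w \<in> X"
  shows "rank1 scale w (B a) \<in> rank1_span scale X W"
    "rank1 scale w (\<lambda>y. B y a) \<in> rank1_span scale X W"
  using assms B_left_in_W B_right_in_W by (auto intro!: rank1_in_span)

lemma mult_in_line_id_plus:
  assumes S: "E.subspace S" "rank1 scale x (B one) - rank1 scale one (B x) \<in> S"
    "rank1 scale x (B one) - rank1 scale one (\<lambda>y. B y x) \<in> S"
  shows "(\<lambda>y. mul x y) \<in> line (fscale scale) id + S" "(\<lambda>y. mul y x) \<in> line (fscale scale) id + S"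
proof -
  have line: "fscale scale c id \<in> line (fscale scale) id" for c
    by (auto simp: in_line_End)
  note left_mult_eq[of x]
  also have "fscale scale (B one x) id + (rank1 scale x (B one) - rank1 scale one (B x)) \<in>
      line (fscale scale) id + S"
    by (intro set_plus_intro line S)
  finally show "(\<lambda>y. mul x y) \<in> line (fscale scale) id + S" .
  note right_mult_eq[of x]
  also have "fscale scale (B one x) id + (rank1 scale x (B one) - rank1 scale one (\<lambda>y. B y x)) \<in>
      line (fscale scale) id + S"
    by (intro set_plus_intro line S)
  finally show "(\<lambda>y. mul y x) \<in> line (fscale scale) id + S" .
qed

lemma End_subalgebra_W: "End_subalgebra scale (rank1_span scale X W)"
  by (rule End_subalgebra_rank1_span) (rule W_linear)

lemma mult_algebra_least:
  assumes "End_subalgebra scale S" "\<And>x. (\<lambda>y. mul x y) \<in> S" "\<And>x. (\<lambda>y. mul y x) \<in> S"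
  shows "M \<subseteq> S"
  unfolding mult_algebra_def by (rule hull_minimal) (use assms in auto)


subsection \<open>The upper bound\<close>

lemma mult_algebra_subset: "M \<subseteq> line (fscale scale) id + rank1_span scale UNIV W"
proof (rule mult_algebra_least)
  let ?N = "rank1_span scale UNIV W"
  show "End_subalgebra scale (line (fscale scale) id + ?N)"
    by (rule End_subalgebra_line_id_plus[OF End_subalgebra_W])
  have "rank1 scale x (B one) - rank1 scale one f \<in> ?N" if "f \<in> W" for x f
    using that B_left_in_W by (intro E.subspace_diff[OF subspace_rank1_span] rank1_in_span) auto
  then show "(\<lambda>y. mul x y) \<in> line (fscale scale) id + ?N"
    "(\<lambda>y. mul y x) \<in> line (fscale scale) id + ?N" for x
    by (intro mult_in_line_id_plus subspace_rank1_span; simp add: B_left_in_W B_right_in_W)+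
qed

lemma mult_in_mult_algebra: "(\<lambda>y. mul x y) \<in> M" "(\<lambda>y. mul y x) \<in> M"
  unfolding mult_algebra_def by (rule hull_inc, blast)+

lemma End_subalgebra_mult_algebra: "End_subalgebra scale M"
proof -
  let ?\<S> = "{t. End_subalgebra scale t \<and> range (\<lambda>x y. mul x y) \<union> range (\<lambda>x y. mul y x) \<subseteq> t}"
  have M: "M = \<Inter> ?\<S>" by (simp add: mult_algebra_def hull_def)
  have "(\<lambda>y. mul x y) \<in> End_space scale" "(\<lambda>y. mul y x) \<in> End_space scale" for x
    by (auto intro!: End_spaceI simp: mul_eq B_simps algebra_simps)
  then have "M \<subseteq> End_space scale"
    by (intro mult_algebra_least End_subalgebra_End_space)
  moreover have "E.subspace M"
    unfolding M by (rule E.subspace_Inter) (auto simp: End_subalgebra_def)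
  moreover have "\<phi> \<circ> \<psi> \<in> M" if "\<phi> \<in> M" "\<psi> \<in> M" for \<phi> \<psi>
    using that unfolding M by (auto simp: End_subalgebra_def)
  ultimately show ?thesis by (simp add: End_subalgebra_def)
qed

lemma mult_algebra_comp: "\<phi> \<in> M \<Longrightarrow> \<psi> \<in> M \<Longrightarrow> \<phi> \<circ> \<psi> \<in> M"
  and subspace_mult_algebra: "E.subspace M"
  using End_subalgebra_mult_algebra by (auto simp: End_subalgebra_def)

lemma id_in_mult_algebra: "id \<in> M"
proof -
  have "(\<lambda>y. mul one y) = id" by (simp add: fun_eq_iff mul_eq B_simps)
  then show ?thesis using mult_in_mult_algebra(1)[of one] by (simp only:)
qed

lemma line_id_subset: "line (fscale scale) id \<subseteq> M"
  using E.subspace_scale[OF subspace_mult_algebra id_in_mult_algebra]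
  by (auto simp: in_line_End)

lemma left_mult_reduced_in_mult_algebra: "rank1 scale x (B one) - rank1 scale one (B x) \<in> M"
proof -
  have "(\<lambda>y. mul x y) - fscale scale (B one x) id \<in> M"
    by (intro E.subspace_diff[OF subspace_mult_algebra] mult_in_mult_algebra
      E.subspace_scale[OF subspace_mult_algebra] id_in_mult_algebra)
  also have "(\<lambda>y. mul x y) - fscale scale (B one x) id =
      rank1 scale x (B one) - rank1 scale one (B x)"
    using left_mult_eq[of x] by (metis add_diff_cancel_left')
  finally show ?thesis .
qed


subsection \<open>The square-zero ideal\<close>

text \<open>Compose with the multiplications: since \<open>B 1 (xy) = 2 B(1, x) B(1, y) - B(x, y)\<close>, the functional
  \<open>B 1 \<circ> L\<^sub>x\<close> is \<open>- B x\<close> up to a multiple of \<open>B 1\<close>, and similarly for \<open>R\<^sub>x\<close>.\<close>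

lemma rank1_in_mult_algebra:
  assumes "rank1 scale w (B one) \<in> M"
  shows "rank1 scale w (B a) \<in> M" "rank1 scale w (\<lambda>y. B y a) \<in> M"
proof -
  let ?r = "rank1 scale w (B one)"
  have r: "fscale scale (2 * B one a) ?r - \<psi> \<in> M" if "\<psi> \<in> M" for \<psi>
    using assms that E.subspace_diff[OF subspace_mult_algebra] E.subspace_scale[OF subspace_mult_algebra]
    by blast
  have comp: "?r \<circ> (\<lambda>y. mul a y) \<in> M" "?r \<circ> (\<lambda>y. mul y a) \<in> M"
    by (intro mult_algebra_comp assms mult_in_mult_algebra)+
  have "rank1 scale w (B a) = fscale scale (2 * B one a) ?r - (?r \<circ> (\<lambda>y. mul a y))"
    "rank1 scale w (\<lambda>y. B y a) = fscale scale (2 * B one a) ?r - (?r \<circ> (\<lambda>y. mul y a))"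
    by (simp_all add: fun_eq_iff rank1_def fscale_def mul_eq B_simps algebra_simps
      flip: scale_left_distrib scale_left_diff_distrib)
  then show "rank1 scale w (B a) \<in> M" "rank1 scale w (\<lambda>y. B y a) \<in> M"
    using r comp by simp_all
qed

lemma rank1_span_R_subset: "rank1_span scale R W \<subseteq> M"
proof (rule rank1_span_W_least[OF subspace_mult_algebra])
  fix r a assume r: "r \<in> R"
  have "(\<lambda>y. mul r y) = rank1 scale r (B one)"
    using r by (simp add: fun_eq_iff mul_eq rank1_def form_radical_def)
  then have "rank1 scale r (B one) \<in> M"
    using mult_in_mult_algebra(1)[of r] by simp
  then show "rank1 scale r (B a) \<in> M" "rank1 scale r (\<lambda>y. B y a) \<in> M"
    by (rule rank1_in_mult_algebra)+
qed

lemma rank1_span_R_square_zero: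
  assumes "\<phi> \<in> rank1_span scale X W" "\<psi> \<in> rank1_span scale R Y"
  shows "\<phi> \<circ> \<psi> = 0"
  using subspace_R W_radical assms by (rule rank1_span_comp_0)

lemma rank1_span_R_ideal: "End_ideal scale M (rank1_span scale R W)"
  unfolding End_ideal_def
proof (intro conjI ballI)
  let ?K = "rank1_span scale R W" and ?N = "rank1_span scale UNIV W"
  show "?K \<subseteq> M" by (rule rank1_span_R_subset)
  show sub: "E.subspace ?K" by (rule subspace_rank1_span)
  fix \<phi> \<psi> assume \<phi>: "\<phi> \<in> M" and \<psi>: "\<psi> \<in> ?K"
  have "\<phi> \<in> line (fscale scale) id + ?N" using \<phi> mult_algebra_subset by blast
  then obtain c \<nu> where eq: "\<phi> = fscale scale c id + \<nu>" and \<nu>: "\<nu> \<in> ?N"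
    by (auto elim!: set_plus_elim simp: in_line_End)
  have lin: "\<psi> \<in> End_space scale"
    using \<psi> End_subalgebra_W by (auto simp: End_subalgebra_def)
  have "\<phi> \<circ> \<psi> = fscale scale c \<psi> + (\<nu> \<circ> \<psi>)"
    by (simp add: eq fun_eq_iff fscale_def)
  then have "\<phi> \<circ> \<psi> = fscale scale c \<psi>"
    using rank1_span_R_square_zero[OF \<nu> \<psi>] by simp
  then show "\<phi> \<circ> \<psi> \<in> ?K" using E.subspace_scale[OF sub \<psi>] by simp
  have "\<psi> \<circ> \<phi> = fscale scale c \<psi> + (\<psi> \<circ> \<nu>)"
    using lin by (simp add: eq fun_eq_iff fscale_def End_add End_scale)
  moreover have "\<psi> \<circ> \<nu> \<in> ?K"
    by (rule rank1_span_comp[OF W_linear \<psi> \<nu>])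
  ultimately show "\<psi> \<circ> \<phi> \<in> ?K"
    using E.subspace_add[OF sub] E.subspace_scale[OF sub \<psi>] by simp
qed


subsection \<open>The annihilator of the radical in finite dimension\<close>

lemma rank1_span_eq_annihilator:
  assumes "finite S" "span S = UNIV"
  shows "rank1_span scale UNIV W = {\<phi> \<in> End_space scale. \<forall>r\<in>R. \<phi> r = 0}"
proof
  show "rank1_span scale UNIV W \<subseteq> {\<phi> \<in> End_space scale. \<forall>r\<in>R. \<phi> r = 0}"
    using End_subalgebra_W rank1_span_kernel W_radical unfolding End_subalgebra_def by blast
  show "{\<phi> \<in> End_space scale. \<forall>r\<in>R. \<phi> r = 0} \<subseteq> rank1_span scale UNIV W"
  proof clarify
    fix \<phi> assume \<phi>: "\<phi> \<in> End_space scale" "\<forall>r\<in>R. \<phi> r = 0"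
    \<comment> \<open>As \<open>S\<close> spans, \<open>R\<close> is the common kernel of these finitely many functionals.\<close>
    let ?F = "(\<lambda>a. B a) ` S \<union> (\<lambda>a y. B y a) ` S"
    have F: "?F \<subseteq> W" using B_left_in_W B_right_in_W by auto
    have "\<phi> \<in> rank1_span scale UNIV ?F"
    proof (rule in_rank1_span_if_vanishes_on_common_kernel)
      show "finite ?F" using assms(1) by simp
      show "Vector_Spaces.linear scale (*) f" if "f \<in> ?F" for f
        using that F W_linear by blast
      fix z assume z: "\<And>f. f \<in> ?F \<Longrightarrow> f z = 0"
      have "subspace {a. B a z = 0 \<and> B z a = 0}"
        by (auto simp: subspace_def B_simps)
      moreover have "S \<subseteq> {a. B a z = 0 \<and> B z a = 0}"
        using z by auto
      ultimately have "UNIV \<subseteq> {a. B a z = 0 \<and> B z a = 0}"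
        using span_minimal assms(2) by metis
      then have "z \<in> R" by (auto simp: form_radical_def)
      then show "\<phi> z = 0" using \<phi>(2) by blast
    qed (fact \<phi>(1))
    moreover have "rank1_span scale UNIV ?F \<subseteq> rank1_span scale UNIV W"
      using F by (intro rank1_span_least subspace_rank1_span) (auto intro: rank1_in_span)
    ultimately show "\<phi> \<in> rank1_span scale UNIV W" by blast
  qed
qed


subsection \<open>Equality in the upper bound\<close>

text \<open>Since \<open>w 1 = w\<close>, composing \<open>1 B 1\<close> with \<open>L\<^sub>w\<close> on the left gives \<open>w B 1\<close> for every \<open>w\<close>.\<close>

lemma mult_algebra_eqI:
  assumes "rank1 scale one (B one) \<in> M"
  shows "M = line (fscale scale) id + rank1_span scale UNIV W"
proof
  show "M \<subseteq> line (fscale scale) id + rank1_span scale UNIV W"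
    by (rule mult_algebra_subset)
  have "rank1_span scale UNIV W \<subseteq> M"
  proof (rule rank1_span_W_least[OF subspace_mult_algebra])
    fix w a
    have "rank1 scale w (B one) = (\<lambda>y. mul w y) \<circ> rank1 scale one (B one)"
      by (simp add: fun_eq_iff rank1_def mul_eq B_simps B_one_right[of w] mult.commute)
    also have "\<dots> \<in> M"
      using mult_algebra_comp mult_in_mult_algebra(1) assms by blast
    finally show "rank1 scale w (B a) \<in> M" "rank1 scale w (\<lambda>y. B y a) \<in> M"
      by (rule rank1_in_mult_algebra)+
  qed
  then show "line (fscale scale) id + rank1_span scale UNIV W \<subseteq> M"
    using line_id_subset E.subspace_add[OF subspace_mult_algebra] by (auto elim!: set_plus_elim)
qed

text \<open>The difference \<open>L\<^sub>x - R\<^sub>x\<close> is the rank one map \<open>g(.)1\<close> with \<open>g(u) = B(u, x) - B(x, u)\<close>. If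
  \<open>g(y) \<noteq> 0\<close>, then \<open>g \<circ> L\<^sub>y\<close> differs from \<open>g(y) B 1\<close> by a multiple of \<open>g\<close>, because
  \<open>g(1) = 0\<close>.\<close>

lemma mult_algebra_not_symmetric:
  assumes "\<not> symmetric_form B"
  shows "M = line (fscale scale) id + rank1_span scale UNIV W"
proof (rule mult_algebra_eqI)
  obtain x y where xy: "B y x \<noteq> B x y" using assms by (auto simp: symmetric_form_def)
  define g where "g u = B u x - B x u" for u
  have gy: "g y \<noteq> 0" using xy by (simp add: g_def)
  have "rank1 scale one g = (\<lambda>u. mul x u) - (\<lambda>u. mul u x)"
    by (simp add: fun_eq_iff rank1_def g_def mul_eq algebra_simps)
  also have "\<dots> \<in> M"
    using E.subspace_diff[OF subspace_mult_algebra] mult_in_mult_algebra by blast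
  finally have g: "rank1 scale one g \<in> M" .
  have "g (mul y u) = B one y * g u + B one u * g y" for u
    by (simp add: g_def mul_eq B_simps B_one_right[of x] algebra_simps)
  then have "rank1 scale one (B one) = fscale scale (1 / g y)
      ((rank1 scale one g \<circ> (\<lambda>u. mul y u)) - fscale scale (B one y) (rank1 scale one g))"
    using gy by (simp add: fun_eq_iff rank1_def fscale_def scale_left_distrib)
  also have "\<dots> \<in> M"
    using g mult_in_mult_algebra(1) mult_algebra_comp E.subspace_diff[OF subspace_mult_algebra]
      E.subspace_scale[OF subspace_mult_algebra] by blast
  finally show "rank1 scale one (B one) \<in> M" .
qed

text \<open>For \<open>x\<close> orthogonal to \<open>1\<close> write \<open>s\<^sub>x = L\<^sub>x = x B 1 - 1 B x\<close>. Then
  \<open>s\<^sub>x s\<^sub>y = - x B y - B(x, y) \<cdot> 1 B 1\<close>; for \<open>x\<close> and \<open>y\<close> orthogonal and nonisotropic this yields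
  \<open>x B y\<close> and \<open>y B x\<close>, whose product is \<open>B(y, y) \<cdot> x B x\<close>, and then \<open>s\<^sub>x s\<^sub>x\<close> yields \<open>1 B 1\<close>.\<close>

lemma reduced_left_mult_comp:
  assumes "B one x = 0" "B one y = 0"
  shows "(rank1 scale x (B one) - rank1 scale one (B x)) \<circ>
      (rank1 scale y (B one) - rank1 scale one (B y)) =
    - rank1 scale x (B y) - fscale scale (B x y) (rank1 scale one (B one))"
  using assms by (simp add: fun_eq_iff rank1_def fscale_def B_simps B_one_right[of x] mult.commute)

lemma mult_algebra_two_orthogonal:
  assumes sym: "symmetric_form B"
    and x: "B one x = 0" "B x x \<noteq> 0" and y: "B one y = 0" "B y y \<noteq> 0" and xy: "B x y = 0"
  shows "M = line (fscale scale) id + rank1_span scale UNIV W"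
proof (rule mult_algebra_eqI)
  note M = E.subspace_diff[OF subspace_mult_algebra] E.subspace_neg[OF subspace_mult_algebra]
    E.subspace_scale[OF subspace_mult_algebra] E.subspace_add[OF subspace_mult_algebra]
  have s: "- rank1 scale u (B v) - fscale scale (B u v) (rank1 scale one (B one)) \<in> M"
    if "B one u = 0" "B one v = 0" for u v
    using mult_algebra_comp[OF left_mult_reduced_in_mult_algebra[of u]
        left_mult_reduced_in_mult_algebra[of v]]
    by (simp only: reduced_left_mult_comp[OF that])
  have orth: "rank1 scale u (B v) \<in> M" if "B one u = 0" "B one v = 0" "B u v = 0" for u v
    using M(2)[OF s[OF that(1,2)]] that(3) by simp
  have "B y x = 0" using sym xy by (simp add: symmetric_form_def)
  then have "rank1 scale x (B y) \<circ> rank1 scale y (B x) \<in> M"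
    using x(1) y(1) xy by (intro mult_algebra_comp orth)
  moreover have "rank1 scale x (B x) =
      fscale scale (1 / B y y) (rank1 scale x (B y) \<circ> rank1 scale y (B x))"
    using y(2) by (simp add: fun_eq_iff rank1_def fscale_def B_simps)
  ultimately have "rank1 scale x (B x) \<in> M" using M(3) by simp
  then have "fscale scale (- 1 / B x x)
      ((- rank1 scale x (B x) - fscale scale (B x x) (rank1 scale one (B one))) + rank1 scale x (B x)) \<in> M"
    by (intro M(3,4) s x(1))
  moreover have "fscale scale (- 1 / B x x)
      ((- rank1 scale x (B x) - fscale scale (B x x) (rank1 scale one (B one))) + rank1 scale x (B x)) =
      rank1 scale one (B one)"
    using x(2) by (simp add: fun_eq_iff rank1_def fscale_def)
  ultimately show "rank1 scale one (B one) \<in> M" by simp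
qed


subsection \<open>Small quotients by the radical of a symmetric form\<close>

lemma mul_commute: "symmetric_form B \<Longrightarrow> mul x y = mul y x"
  by (simp add: mul_eq symmetric_form_def add.commute)

text \<open>Polarization: \<open>B(u + v, u + v) = B(u, u) + B(v, v) + 2 B(u, v)\<close>.\<close>

lemma symmetric_form_zero_if_isotropic:
  assumes sym: "symmetric_form B" and two: "(2 :: 'f) \<noteq> 0"
    and "B u u = 0" "B v v = 0" "B (u + v) (u + v) = 0"
  shows "B u v = 0"
proof -
  have "B (u + v) (u + v) = B u u + B v v + 2 * B u v"
    using sym by (simp add: symmetric_form_def B_simps)
  then show ?thesis using assms by simp
qed

text \<open>The first steps of Gram-Schmidt from \<open>1\<close>: if the vectors found so far do not span modulo the
  radical, then \<open>B\<close> is not zero on their orthogonal complement, and by polarization the complement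
  contains a nonisotropic vector.\<close>

lemma symmetric_form_cases:
  assumes sym: "symmetric_form B" and two: "(2 :: 'f) \<noteq> 0"
  obtains (scalars) "\<And>z. B one z = 0 \<Longrightarrow> z \<in> R"
    | (plane) x where "B one x = 0" "B x x \<noteq> 0"
        "\<And>z. z - scale (B one z) one - scale (B x z / B x x) x \<in> R"
    | (large) x y where "B one x = 0" "B x x \<noteq> 0" "B one y = 0" "B y y \<noteq> 0" "B x y = 0"
proof -
  have radI: "z \<in> R" if "\<And>a. B z a = 0" for z
    using sym that by (auto simp: form_radical_def symmetric_form_def)
  have comm: "B u v = B v u" for u v
    using sym by (simp add: symmetric_form_def)
  consider "\<And>z. B one z = 0 \<Longrightarrow> z \<in> R" | v where "B one v = 0" "v \<notin> R" by blast
  then show thesis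
  proof cases
    case 1
    then show thesis by (rule scalars)
  next
    case 2
    then obtain a where a: "B v a \<noteq> 0" using radI by blast
    let ?a = "a - scale (B one a) one"
    \<comment> \<open>Subtracting the component along \<open>1\<close> keeps \<open>B v a\<close>, because \<open>v\<close> is orthogonal to \<open>1\<close>;
      polarization then makes one of \<open>v\<close>, \<open>?a\<close>, \<open>v + ?a\<close> nonisotropic.\<close>
    have "B one ?a = 0" "B v ?a \<noteq> 0"
      using a 2(1) by (auto simp: B_simps B_one_right[of v])
    then obtain x where x: "B one x = 0" "B x x \<noteq> 0"
      using symmetric_form_zero_if_isotropic[OF sym two, of v ?a] 2(1)
      by (metis B_add_right add.right_neutral)
    show thesis
    proof (cases "\<exists>y. B one y = 0 \<and> B x y = 0 \<and> B y y \<noteq> 0")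
      case True
      then show thesis using large x by blast
    next
      case False
      let ?p = "\<lambda>z. z - scale (B one z) one - scale (B x z / B x x) x"
      have p: "B one (?p z) = 0" "B x (?p z) = 0" for z
        using x by (auto simp: B_simps B_one_right[of x])
      \<comment> \<open>The orthogonal complement of \<open>1\<close> and \<open>x\<close> is totally isotropic, hence lies in the radical;
        \<open>?p\<close> is the orthogonal projection onto it.\<close>
      have iso: "B u u = 0" if "B one u = 0" "B x u = 0" for u
        using False that by blast
      have "?p z \<in> R" for z
      proof (rule radI)
        fix a
        have "B (?p z) (?p a) = 0"
          by (rule symmetric_form_zero_if_isotropic[OF sym two iso iso iso])
            (simp_all only: B_add_right p add_0)
        moreover have "B (?p z) (?p a) = B (?p z) a"
          unfolding B_diff_right[of "?p z"] B_scale_right[of "?p z"]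
          using p[of z] comm[of "?p z" one] comm[of "?p z" x] by simp
        ultimately show "B (?p z) a = 0" by simp
      qed
      then show thesis using plane x by blast
    qed
  qed
qed

lemma B_sum_right: "finite T \<Longrightarrow> B x (\<Sum>v\<in>T. f v) = (\<Sum>v\<in>T. B x (f v))"
  by (induction T rule: finite_induct) (auto simp: B_simps)

lemma orthogonal_independent_mod_R:
  assumes T: "finite T" "\<And>v w. v \<in> T \<Longrightarrow> w \<in> T \<Longrightarrow> v \<noteq> w \<Longrightarrow> B v w = 0" "\<And>v. v \<in> T \<Longrightarrow> B v v \<noteq> 0"
    and sum: "(\<Sum>v\<in>T. scale (u v) v) \<in> R"
  shows "\<forall>v\<in>T. u v = 0"
proof
  fix w assume w: "w \<in> T"
  have "0 = B w (\<Sum>v\<in>T. scale (u v) v)"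
    using sum by (simp add: form_radical_def)
  also have "\<dots> = (\<Sum>v\<in>T. u v * B w v)"
    using T(1) by (simp add: B_sum_right B_scale_right)
  also have "\<dots> = (\<Sum>v\<in>T. if v = w then u w * B w w else 0)"
    using T(2) w by (intro sum.cong) auto
  also have "\<dots> = u w * B w w"
    using T(1) w by simp
  finally show "u w = 0" using T(3)[OF w] by simp
qed

lemma quotient_dim_scalars:
  assumes "\<And>z. B one z = 0 \<Longrightarrow> z \<in> R"
  shows "quotient_dim scale R = 1"
proof -
  have "z \<in> span {one} + R" for z
  proof -
    have "z - scale (B one z) one \<in> R"
      by (rule assms) (simp add: B_simps)
    then have "scale (B one z) one + (z - scale (B one z) one) \<in> span {one} + R"
      by (intro set_plus_intro) (auto simp: span_singleton)
    then show ?thesis by simp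
  qed
  then have "quotient_dim scale R = enat (card {one})"
    by (intro quotient_dim_eqI subspace_R orthogonal_independent_mod_R) (auto simp: B_simps)
  then show ?thesis by (simp add: one_enat_def)
qed

lemma orthogonal_neq:
  assumes "B u v = 0" "B u u \<noteq> 0"
  shows "u \<noteq> v"
  using assms by blast

lemma quotient_dim_plane:
  assumes x: "B one x = 0" "B x x \<noteq> 0"
    and rep: "\<And>z. z - scale (B one z) one - scale (B x z / B x x) x \<in> R"
  shows "quotient_dim scale R = 2"
proof -
  have "z \<in> span {one, x} + R" for z
  proof -
    have "scale (B one z) one + scale (B x z / B x x) x \<in> span {one, x}"
      by (intro span_add span_scale span_base) auto
    then have "(scale (B one z) one + scale (B x z / B x x) x) +
        (z - scale (B one z) one - scale (B x z / B x x) x) \<in> span {one, x} + R"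
      using rep by (rule set_plus_intro)
    then show ?thesis by simp
  qed
  then have "quotient_dim scale R = enat (card {one, x})"
    using x B_one_right[of x]
    by (intro quotient_dim_eqI subspace_R orthogonal_independent_mod_R) (auto simp: B_one_one)
  moreover have "one \<noteq> x" using x B_one_one by (intro orthogonal_neq) auto
  ultimately show ?thesis by (simp add: numeral_eq_enat)
qed

lemma quotient_dim_large:
  assumes sym: "symmetric_form B"
    and x: "B one x = 0" "B x x \<noteq> 0" and y: "B one y = 0" "B y y \<noteq> 0" and xy: "B x y = 0"
  shows "3 \<le> quotient_dim scale R"
proof -
  have "B y x = 0" using sym xy by (simp add: symmetric_form_def)
  then have "enat (card {one, x, y}) \<le> quotient_dim scale R"
    using x y xy B_one_right[of x] B_one_right[of y]
    by (intro quotient_dim_ge subspace_R orthogonal_independent_mod_R) (auto simp: B_one_one)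
  moreover have "one \<noteq> x" "one \<noteq> y" "x \<noteq> y"
    using x y xy B_one_one by (auto dest: orthogonal_neq)
  ultimately show ?thesis by (simp add: numeral_eq_enat numeral_3_eq_3)
qed

lemma mult_algebra_symmetric_large:
  assumes sym: "symmetric_form B" and two: "(2 :: 'f) \<noteq> 0" and dim: "quotient_dim scale R \<ge> 3"
  shows "M = line (fscale scale) id + rank1_span scale UNIV W"
  using sym two
proof (cases rule: symmetric_form_cases)
  case scalars
  then have "quotient_dim scale R = 1" by (rule quotient_dim_scalars)
  then show ?thesis using dim by (simp add: one_enat_def numeral_eq_enat)
next
  case (plane x)
  then have "quotient_dim scale R = 2" by (rule quotient_dim_plane)
  then show ?thesis using dim by (simp add: numeral_eq_enat)
next
  case (large x y)
  then show ?thesis using mult_algebra_two_orthogonal[OF sym] by blast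
qed

lemma direct_sum_EndI:
  assumes "E.subspace U" "E.subspace U'" "X = U + U'" "\<And>\<phi>. \<phi> \<in> U \<Longrightarrow> \<phi> \<in> U' \<Longrightarrow> \<phi> = 0"
  shows "direct_sum X U U'"
  using E.subspace_0[OF assms(1)] E.subspace_0[OF assms(2)] assms(3,4)
  unfolding direct_sum_def by blast

text \<open>Modulo the radical everything is a multiple of \<open>1\<close>, so \<open>B(x, y) = B(1, x) B(1, y)\<close>, and
  \<open>L\<^sub>x - B(1, x) id\<close> collapses to \<open>r B 1\<close>, where \<open>r = x - B(1, x)1\<close> lies in the radical. The sum
  is direct because the maps of the ideal have values in the radical, which does not contain nonzero
  multiples of \<open>1\<close>.\<close>

lemma mult_algebra_scalars:
  assumes sym: "symmetric_form B" and dim: "quotient_dim scale R = 1" and two: "(2 :: 'f) \<noteq> 0"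
  shows "direct_sum M (line (fscale scale) id) (rank1_span scale R W)"
    and "rank1_span scale R {B one} = rank1_span scale R W"
proof -
  let ?K = "rank1_span scale R W"
  have scalars: "z \<in> R" if "B one z = 0" for z
    using sym two
  proof (cases rule: symmetric_form_cases)
    case scalars
    then show ?thesis using that by blast
  next
    case (plane x)
    then have "quotient_dim scale R = 2" by (rule quotient_dim_plane)
    then show ?thesis using dim by (simp add: one_enat_def numeral_eq_enat)
  next
    case (large x y)
    then have "3 \<le> quotient_dim scale R" by (rule quotient_dim_large[OF sym])
    then show ?thesis using dim by (simp add: one_enat_def numeral_eq_enat)
  qed
  have r: "x - scale (B one x) one \<in> R" for x
    by (rule scalars) (simp add: B_simps)
  have B_eq: "B x y = B one x * B one y" for x y
  proof -
    have "B (x - scale (B one x) one) y = 0" using r by (simp add: form_radical_def)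
    then show ?thesis by (simp add: B_simps)
  qed
  have "M = line (fscale scale) id + ?K"
  proof
    show "M \<subseteq> line (fscale scale) id + ?K"
    proof (rule mult_algebra_least)
      show "End_subalgebra scale (line (fscale scale) id + ?K)"
        by (rule End_subalgebra_line_id_plus[OF End_subalgebra_W])
      fix x
      have "rank1 scale x (B one) - rank1 scale one (B x) = rank1 scale (x - scale (B one x) one) (B one)"
        by (simp add: fun_eq_iff rank1_def B_eq[of x] algebra_simps)
      also have "\<dots> \<in> ?K" by (rule rank1_in_rank1_span_W[OF r])
      finally have K: "rank1 scale x (B one) - rank1 scale one (B x) \<in> ?K" .
      have "(\<lambda>y. B y x) = B x" using sym by (auto simp: symmetric_form_def)
      then show "(\<lambda>y. mul x y) \<in> line (fscale scale) id + ?K"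
        "(\<lambda>y. mul y x) \<in> line (fscale scale) id + ?K"
        using K by (intro mult_in_line_id_plus subspace_rank1_span; simp)+
    qed
    show "line (fscale scale) id + ?K \<subseteq> M"
      using line_id_subset rank1_span_R_subset E.subspace_add[OF subspace_mult_algebra]
      by (auto elim!: set_plus_elim)
  qed
  moreover have "\<phi> = 0" if \<phi>: "\<phi> \<in> line (fscale scale) id" "\<phi> \<in> ?K" for \<phi>
  proof -
    obtain c where c: "\<phi> = fscale scale c id" using \<phi>(1) by (auto simp: in_line_End)
    have "\<phi> one \<in> R" by (rule rank1_span_image[OF \<phi>(2) subspace_R])
    then have "B one (scale c one) = 0" by (simp add: c fscale_def form_radical_def)
    then show ?thesis by (simp add: c fscale_def B_simps fun_eq_iff)
  qed
  ultimately show "direct_sum M (line (fscale scale) id) ?K"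
    by (intro direct_sum_EndI subspace_line subspace_rank1_span)
  show "rank1_span scale R {B one} = ?K"
  proof
    show "rank1_span scale R {B one} \<subseteq> ?K"
      using B_left_in_W by (intro rank1_span_least subspace_rank1_span) (auto intro: rank1_in_span)
    have sc: "fscale scale c (rank1 scale w (B one)) \<in> rank1_span scale R {B one}" if "w \<in> R" for c w
      using that by (intro E.subspace_scale[OF subspace_rank1_span] rank1_in_span) auto
    have left: "rank1 scale w (B a) \<in> rank1_span scale R {B one}" if "w \<in> R" for w a
    proof -
      have "fscale scale (B one a) (rank1 scale w (B one)) = rank1 scale w (B a)"
        unfolding rank1_def fscale_def fun_eq_iff by (subst (2) B_eq) simp
      then show ?thesis using sc[OF that, of "B one a"] by (simp only:)
    qed
    have "(\<lambda>y. B y a) = B a" for a using sym by (auto simp: symmetric_form_def)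
    then show "?K \<subseteq> rank1_span scale R {B one}"
      using left by (intro rank1_span_W_least subspace_rank1_span) (simp_all only:)
  qed
qed

text \<open>For \<open>A = \<F>1 \<oplus> \<F>x \<oplus> rad B\<close>, modulo the square-zero ideal \<open>M\<close> is generated by \<open>id\<close> and
  \<open>s = L\<^sub>x\<close>, which acts on \<open>\<F>1 \<oplus> \<F>x\<close> with \<open>s\<^sup>2 = - B(x, x) \<pi>\<close>. Hence \<open>id\<close>, \<open>s\<close>, \<open>\<pi>\<close> span
  a subalgebra, and with the ideal it contains all multiplications. The sum is direct: evaluating an
  element \<open>a id + b s + c \<pi>\<close> of the ideal at \<open>1\<close> gives \<open>b = 0\<close> and \<open>c = - a\<close>, and \<open>a (id - \<pi>)\<close>
  takes the same value at \<open>u\<close> and at \<open>u - \<pi>(u)\<close>, where the ideal vanishes.\<close>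

lemma mult_algebra_plane:
  fixes x
  defines "s \<equiv> rank1 scale x (B one) - rank1 scale one (B x)"
    and "p \<equiv> rank1 scale one (B one) + rank1 scale (scale (1 / B x x) x) (B x)"
  assumes sym: "symmetric_form B"
    and x: "B one x = 0" "B x x \<noteq> 0"
    and rep: "\<And>z. z - scale (B one z) one - scale (B x z / B x x) x \<in> R"
  shows "direct_sum M (line (fscale scale) id + line (fscale scale) s + line (fscale scale) p)
    (rank1_span scale R W)"
proof -
  let ?K = "rank1_span scale R W"
  let ?I = "line (fscale scale) s + line (fscale scale) p"
  let ?D = "line (fscale scale) id + ?I"
  have x1: "B x one = 0" using x(1) B_one_right by simp
  have s_End: "s \<in> End_space scale" and p_End: "p \<in> End_space scale"
    unfolding s_def p_def using B_linear_right
    by (auto intro!: E.subspace_diff[OF subspace_End_space] E.subspace_add[OF subspace_End_space]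
      rank1_in_End)
  have s: "s u = scale (B one u) x - scale (B x u) one"
    and p: "p u = scale (B one u) one + scale (B x u / B x x) x" for u
    by (simp_all add: s_def p_def rank1_def)
  have ss: "s (s u) = scale (- B x x) (p u)" and sp: "s (p u) = s u" and ps: "p (s u) = s u"
    and pp: "p (p u) = p u" for u
    using x x1 by (simp_all add: s p B_simps scale_right_distrib)
  have I_elim: "\<exists>a b. \<phi> = fscale scale a s + fscale scale b p" if "\<phi> \<in> ?I" for \<phi>
    using that vector_space.in_line_plus_line[OF E.vector_space_axioms] by blast
  have I_intro: "fscale scale a s + fscale scale b p \<in> ?I" for a b
    by (rule set_plus_intro) (auto simp: in_line_End)
  have "End_subalgebra scale ?I"
    unfolding End_subalgebra_def
  proof (intro conjI ballI)
    show "?I \<subseteq> End_space scale"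
      using I_elim s_End p_End E.subspace_add[OF subspace_End_space] E.subspace_scale[OF subspace_End_space]
      by blast
    show "E.subspace ?I" by (intro End_subspace_plus subspace_line)
    fix \<phi> \<psi> assume "\<phi> \<in> ?I" "\<psi> \<in> ?I"
    then obtain a b a' b' where eq: "\<phi> = fscale scale a s + fscale scale b p"
      "\<psi> = fscale scale a' s + fscale scale b' p"
      using I_elim by metis
    have "\<phi> \<circ> \<psi> = fscale scale (a * b' + b * a') s + fscale scale (b * b' - a * a' * B x x) p"
      by (simp add: eq fun_eq_iff fscale_def End_add[OF s_End] End_scale[OF s_End] End_add[OF p_End]
        End_scale[OF p_End] ss sp ps pp algebra_simps)
    then show "\<phi> \<circ> \<psi> \<in> ?I" using I_intro by simp
  qed
  then have D: "End_subalgebra scale ?D" by (rule End_subalgebra_line_id_plus)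
  have s_M: "s \<in> M" unfolding s_def by (rule left_mult_reduced_in_mult_algebra)
  have "p = fscale scale (- 1 / B x x) (s \<circ> s)"
    using x(2) by (simp add: fun_eq_iff fscale_def ss)
  also have "\<dots> \<in> M"
    by (intro E.subspace_scale[OF subspace_mult_algebra] mult_algebra_comp s_M)
  finally have p_M: "p \<in> M" .
  have D_M: "?D \<subseteq> M"
    using s_M p_M id_in_mult_algebra E.subspace_add[OF subspace_mult_algebra]
      E.subspace_scale[OF subspace_mult_algebra]
    by (auto elim!: set_plus_elim simp: in_line_End)
  have "M = ?D + ?K"
  proof
    show "?D + ?K \<subseteq> M"
      using D_M rank1_span_R_subset E.subspace_add[OF subspace_mult_algebra]
      by (auto elim!: set_plus_elim)
    show "M \<subseteq> ?D + ?K"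
    proof (rule mult_algebra_least)
      show "End_subalgebra scale (?D + ?K)"
        using D_M rank1_span_R_ideal
        by (intro End_subalgebra_plus D End_subalgebra_W) (auto simp: End_ideal_def)
      fix z
      let ?r = "z - scale (B one z) one - scale (B x z / B x x) x"
      have "B ?r u = 0" for u using rep by (simp add: form_radical_def)
      then have B_z: "B z u = B one z * B one u + B x z / B x x * B x u" for u
        by (simp add: B_simps algebra_simps)
      have "(\<lambda>y. mul z y) = (fscale scale (B one z) id +
          (fscale scale (B x z / B x x) s + fscale scale 0 p)) + rank1 scale ?r (B one)"
        by (simp add: fun_eq_iff mul_eq fscale_def rank1_def s B_z algebra_simps)
      also have "\<dots> \<in> ?D + ?K"
        by (intro set_plus_intro[of _ ?D] set_plus_intro[of _ "line (fscale scale) id"] I_intro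
          rank1_in_rank1_span_W rep) (auto simp: in_line_End)
      finally show "(\<lambda>y. mul z y) \<in> ?D + ?K" .
      then show "(\<lambda>y. mul y z) \<in> ?D + ?K"
        using mul_commute[OF sym] by simp
    qed
  qed
  moreover have "\<phi> = 0" if D: "\<phi> \<in> ?D" and K: "\<phi> \<in> ?K" for \<phi>
  proof -
    obtain \<iota> \<psi> where "\<phi> = \<iota> + \<psi>" "\<iota> \<in> line (fscale scale) id" "\<psi> \<in> ?I"
      using D by (rule set_plus_elim)
    then obtain a b c where \<phi>: "\<phi> = fscale scale a id + (fscale scale b s + fscale scale c p)"
      using I_elim unfolding in_line_End by metis
    have "\<phi> one \<in> R" by (rule rank1_span_image[OF K subspace_R])
    then have "B one (\<phi> one) = 0" "B x (\<phi> one) = 0" by (auto simp: form_radical_def)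
    then have "a + c = 0" "b = 0"
      using x x1 by (auto simp: \<phi> fscale_def s p B_simps)
    then have \<phi>': "\<phi> u = scale a (u - p u)" for u
      by (simp add: \<phi> fscale_def add_eq_0_iff algebra_simps)
    show ?thesis
    proof
      fix u
      have "u - p u \<in> R" using rep[of u] by (simp add: p diff_diff_eq)
      then have "\<phi> (u - p u) = 0" using rank1_span_kernel[OF K] W_radical by blast
      then show "\<phi> u = 0 u"
        by (simp add: \<phi>' End_diff[OF p_End] pp)
    qed
  qed
  ultimately have "direct_sum M ?D ?K"
    by (intro direct_sum_EndI End_subspace_plus subspace_line subspace_rank1_span)
  then show ?thesis by (simp only: add.assoc)
qed

lemma plane_direct_sum3:
  assumes x: "B one x = 0" "B x x \<noteq> 0"
    and rep: "\<And>z. z - scale (B one z) one - scale (B x z / B x x) x \<in> R"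
  shows "direct_sum3 UNIV (line scale one) (line scale x) R"
proof -
  have x1: "B x one = 0" using x(1) B_one_right by simp
  have zero: "a = 0 \<and> b = 0" if "scale a one + scale b x \<in> R" for a b
  proof -
    have "B one (scale a one + scale b x) = 0" "B x (scale a one + scale b x) = 0"
      using that by (auto simp: form_radical_def)
    then show ?thesis using x x1 by (auto simp: B_simps)
  qed
  have "z \<in> line scale one + line scale x + R" for z
  proof -
    have "(scale (B one z) one + scale (B x z / B x x) x) +
        (z - scale (B one z) one - scale (B x z / B x x) x) \<in> line scale one + line scale x + R"
      by (intro set_plus_intro[OF _ rep]) (auto simp: in_line_plus_line)
    then show ?thesis by simp
  qed
  moreover have "(line scale one + line scale x) \<inter> R = {0}"
  proof (intro equalityI subsetI)
    fix z assume z: "z \<in> (line scale one + line scale x) \<inter> R"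
    then obtain a b where "z = scale a one + scale b x" by (auto simp: in_line_plus_line)
    then show "z \<in> {0}" using z zero[of a b] by simp
  next
    fix z :: 'a assume z: "z \<in> {0}"
    then have "z = scale 0 one + scale 0 x" by simp
    then have "z \<in> line scale one + line scale x" using in_line_plus_line by metis
    then show "z \<in> (line scale one + line scale x) \<inter> R"
      using z subspace_0[OF subspace_R] by simp
  qed
  moreover have "line scale one \<inter> line scale x = {0}"
  proof -
    have "z = 0" if "z = scale a one" "z = scale b x" for z a b
    proof -
      have "scale a one + scale (- b) x = 0" using that by simp
      then have "a = 0" using zero subspace_0[OF subspace_R] by metis
      then show ?thesis using that by simp
    qed
    then show ?thesis by (fastforce simp: in_line)
  qed
  ultimately show ?thesis by (auto simp: direct_sum3_def direct_sum_def)
qed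

text \<open>Here \<open>x\<close> is any element of \<open>V\<close> completing the decomposition. If it were isotropic, it would be
  orthogonal to \<open>1\<close>, \<open>x\<close> and \<open>rad B\<close>, hence lie in \<open>rad B\<close>; so it would vanish, and the quotient
  would have dimension one.\<close>

lemma direct_sum3_plane:
  assumes sym: "symmetric_form B" and dim: "quotient_dim scale R \<noteq> 1"
    and x1: "B one x = 0"
    and sum: "direct_sum3 UNIV (line scale one) (line scale x) R"
  shows "B x x \<noteq> 0" "z - scale (B one z) one - scale (B x z / B x x) x \<in> R"
proof -
  have dec: "\<exists>a b r. r \<in> R \<and> z = scale a one + scale b x + r" for z
  proof -
    have "z \<in> line scale one + line scale x + R"
      using sum by (auto simp: direct_sum3_def direct_sum_def)
    then obtain w r where "z = w + r" "w \<in> line scale one + line scale x" "r \<in> R"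
      by (rule set_plus_elim)
    then show ?thesis unfolding in_line_plus_line by blast
  qed
  have B_r: "B a r = 0" "B r a = 0" if "r \<in> R" for a r
    using that by (auto simp: form_radical_def)
  have x1': "B x one = 0" using x1 B_one_right by simp
  show xx: "B x x \<noteq> 0"
  proof
    assume xx: "B x x = 0"
    have "B x z = 0" for z
      using dec[of z] xx x1' by (auto simp: B_simps B_r)
    then have "x \<in> R" using sym by (auto simp: form_radical_def symmetric_form_def)
    have "x = scale 0 one + scale 1 x" by simp
    then have "x \<in> line scale one + line scale x" unfolding in_line_plus_line by blast
    then have "x = 0"
      using \<open>x \<in> R\<close> sum by (auto simp: direct_sum3_def direct_sum_def)
    have "quotient_dim scale R = 1"
    proof (rule quotient_dim_scalars)
      fix z assume z: "B one z = 0"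
      obtain a b r where "r \<in> R" "z = scale a one + scale b x + r" using dec by blast
      then show "z \<in> R" using z \<open>x = 0\<close> by (simp add: B_simps B_r)
    qed
    then show False using dim by simp
  qed
  obtain a b r where r: "r \<in> R" and z: "z = scale a one + scale b x + r" using dec by blast
  have "B one z = a" "B x z = b * B x x"
    using x1 x1' by (auto simp: z B_simps B_r[OF r])
  then have "z - scale (B one z) one - scale (B x z / B x x) x = r"
    using xx by (simp add: z)
  then show "z - scale (B one z) one - scale (B x z / B x x) x \<in> R" using r by simp
qed

lemma ex_plane:
  assumes sym: "symmetric_form B" and two: "(2 :: 'f) \<noteq> 0" and dim: "quotient_dim scale R = 2"
  shows "\<exists>x. B one x = 0 \<and> direct_sum3 UNIV (line scale one) (line scale x) R"
  using sym two
proof (cases rule: symmetric_form_cases)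
  case scalars
  then have "quotient_dim scale R = 1" by (rule quotient_dim_scalars)
  then show ?thesis using dim by (simp add: one_enat_def numeral_eq_enat)
next
  case (plane x)
  then show ?thesis using plane_direct_sum3 by blast
next
  case (large x y)
  then have "3 \<le> quotient_dim scale R" by (rule quotient_dim_large[OF sym])
  then show ?thesis using dim by (simp add: numeral_eq_enat)
qed

lemma proj_along_eqI:
  assumes "subspace S" "subspace T" "S \<inter> T = {0}" "u \<in> S" "a - u \<in> T"
  shows "proj_along S T a = u"
  unfolding proj_along_def
proof (rule the_equality)
  fix v assume v: "v \<in> S \<and> a - v \<in> T"
  have "v - u \<in> S" using v assms subspace_diff by blast
  moreover have "(a - u) - (a - v) \<in> T" using v assms subspace_diff by blast
  ultimately have "v - u \<in> S \<inter> T" by simp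
  then show "v = u" using assms(3) by simp
qed (use assms in auto)

lemma line_fscale: "c \<noteq> 0 \<Longrightarrow> line (fscale scale) (fscale scale c \<phi>) = line (fscale scale) \<phi>"
proof -
  assume c: "c \<noteq> 0"
  have "fscale scale a \<phi> = fscale scale (a / c) (fscale scale c \<phi>)" for a
    using c by (simp add: fscale_def)
  then have "\<exists>b. fscale scale a \<phi> = fscale scale b (fscale scale c \<phi>)" for a by blast
  moreover have "fscale scale a (fscale scale c \<phi>) = fscale scale (a * c) \<phi>" for a
    by (simp add: fscale_def)
  ultimately show ?thesis by (auto simp: in_line_End)
qed

text \<open>For symmetric \<open>B\<close> the polar form of the norm is \<open>2 B\<close>, which is the origin of the factors in
  \<open>\<sigma>\<close>.\<close>

lemma mult_algebra_direct_sum3: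
  fixes x
  defines "\<pi> \<equiv> proj_along (line scale one + line scale x) R"
    and "\<sigma> \<equiv> rank1 scale x (\<lambda>y. 2 * B one y) - rank1 scale one (\<lambda>y. 2 * B x y)"
  assumes sym: "symmetric_form B" and two: "(2 :: 'f) \<noteq> 0" and dim: "quotient_dim scale R = 2"
    and x: "B one x = 0" and sum: "direct_sum3 UNIV (line scale one) (line scale x) R"
  shows "Vector_Spaces.linear scale scale \<pi>" "\<pi> one = one" "\<pi> x = x" "\<forall>r\<in>R. \<pi> r = 0"
    "direct_sum M (line (fscale scale) id + line (fscale scale) \<sigma> + line (fscale scale) \<pi>)
      (rank1_span scale R W)"
proof -
  have "quotient_dim scale R \<noteq> 1" using dim by (simp add: one_enat_def numeral_eq_enat)
  note plane = direct_sum3_plane[OF sym this x sum]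
  let ?p = "rank1 scale one (B one) + rank1 scale (scale (1 / B x x) x) (B x)"
  have x1: "B x one = 0" using x B_one_right by simp
  have "\<pi> u = ?p u" for u
    unfolding \<pi>_def
  proof (rule proj_along_eqI)
    show "subspace (line scale one + line scale x)"
      by (intro subspace_plus) (auto simp: line_def subspace_span)
    show "(line scale one + line scale x) \<inter> R = {0}"
      using sum by (auto simp: direct_sum3_def direct_sum_def)
    show "?p u \<in> line scale one + line scale x"
      by (auto simp: in_line_plus_line rank1_def)
    show "u - ?p u \<in> R"
      using plane(2)[of u] by (simp add: rank1_def diff_diff_eq)
  qed (rule subspace_R)
  then have \<pi>: "\<pi> = ?p" by auto
  have "?p \<in> End_space scale"
    by (intro E.subspace_add[OF subspace_End_space] rank1_in_End B_linear_right)
  then show "Vector_Spaces.linear scale scale \<pi>" by (simp add: \<pi> End_space_def)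
  show "\<pi> one = one" "\<pi> x = x" "\<forall>r\<in>R. \<pi> r = 0"
    using plane(1) x x1 by (auto simp: \<pi> rank1_def B_one_one form_radical_def)
  have "\<sigma> = fscale scale 2 (rank1 scale x (B one) - rank1 scale one (B x))"
    by (simp add: \<sigma>_def fun_eq_iff fscale_def rank1_def scale_right_diff_distrib)
  then have "line (fscale scale) \<sigma> = line (fscale scale) (rank1 scale x (B one) - rank1 scale one (B x))"
    using line_fscale[OF two] by simp
  then show "direct_sum M (line (fscale scale) id + line (fscale scale) \<sigma> + line (fscale scale) \<pi>)
      (rank1_span scale R W)"
    using mult_algebra_plane[OF sym x plane] by (simp add: \<pi>)
qed

end


section \<open>Vidinli algebras\<close>

lemma two_neq_zero_if_CHAR_neq_2:
  assumes "CHAR('f::field) \<noteq> 2"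
  shows "(2 :: 'f) \<noteq> 0"
proof
  assume "(2 :: 'f) = 0"
  then have dvd: "CHAR('f) dvd 2"
    using of_nat_eq_0_iff_char_dvd[where 'a = 'f, of 2] by simp
  then have "CHAR('f) \<le> 2" by (rule dvd_imp_le) simp
  moreover have "CHAR('f) \<noteq> 0" using dvd by (metis dvd_0_left zero_neq_numeral)
  ultimately have "CHAR('f) = 1" using assms by linarith
  then show False by simp
qed

context vidinli_algebra
begin

lemma polar_commute: "polar q x y = polar q y x"
  by (simp add: polar_def add.commute)

lemma polar_add_left: "polar q (x + y) z = polar q x z + polar q y z"
  and polar_scale_left: "polar q (scale c x) z = c * polar q x z"
  and q_scale: "q (scale c x) = c\<^sup>2 * q x"
  using quadratic_form_norm by (auto simp: quadratic_form_def Vector_Spaces.linear_iff)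

lemma mul_add_left: "mul (x + y) z = mul x z + mul y z"
  and mul_add_right: "mul z (x + y) = mul z x + mul z y"
  and mul_scale_left: "mul (scale c x) z = scale c (mul x z)"
  and mul_scale_right: "mul z (scale c x) = scale c (mul z x)"
  using linear_mul_left linear_mul_right by (auto simp: Vector_Spaces.linear_iff)

lemma one_neq_zero: "one \<noteq> 0"
  using q_scale[of 0 0] norm_one by auto

abbreviation omega :: "'b \<Rightarrow> 'b \<Rightarrow> 'a" where "omega \<equiv> vidinli_omega scale mul one"

text \<open>Bilinearity of \<open>\<omega>\<close> comes from comparing coefficients of \<open>1\<close> in commutators.\<close>

lemma omega_eqI: "mul x y - mul y x = scale c one \<Longrightarrow> omega x y = c"
  using commutator_omega[of x y] one_neq_zero by simp

lemma omega_swap: "omega y x = - omega x y"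
  by (rule omega_eqI) (simp flip: commutator_omega)

lemma omega_add_left: "omega (x + x') y = omega x y + omega x' y"
  by (rule omega_eqI) (simp add: scale_left_distrib mul_add_left mul_add_right flip: commutator_omega)

lemma omega_scale_left: "omega (scale c x) y = c * omega x y"
  by (rule omega_eqI)
    (simp add: mul_scale_left mul_scale_right scale_right_diff_distrib
      flip: commutator_omega scale_scale)

lemma omega_add_right: "omega y (x + x') = omega y x + omega y x'"
  and omega_scale_right: "omega y (scale c x) = c * omega y x"
  using omega_add_left omega_scale_left omega_swap by (metis minus_add_distrib, metis mult_minus_right)

lemma polar_add_right: "polar q z (x + y) = polar q z x + polar q z y"
  and polar_scale_right: "polar q z (scale c x) = c * polar q z x"
  by (simp_all add: polar_commute[of z] polar_add_left polar_scale_left)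

lemma omega_one: "omega one x = 0"
  by (rule omega_eqI) (simp add: one_mul mul_one)

abbreviation (input) B where "B \<equiv> vidinli_form scale mul one q"

lemma vidinli_form_one:
  shows "B one x = polar q x one / 2" "B x one = polar q x one / 2"
  using omega_swap[of one x] by (simp_all add: vidinli_form_def omega_one polar_commute[of one])

text \<open>Linearizing \<open>x\<^sup>2 - q(x, 1)x + q(x)1 = 0\<close> gives \<open>xy + yx = q(x, 1)y + q(y, 1)x - q(x, y)1\<close>. Adding
  \<open>xy - yx = \<omega>(x, y)1\<close> and halving expresses the product through \<open>B\<close> alone.\<close>

lemma form_algebra_vidinli_form:
  assumes two: "(2 :: 'a) \<noteq> 0"
  shows "form_algebra scale B mul one"
proof
  note simps = vidinli_form_def polar_add_left polar_scale_left omega_add_left omega_scale_left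
    polar_add_right polar_scale_right omega_add_right omega_scale_right
    add_divide_distrib diff_divide_distrib algebra_simps
  show add: "B (x + x') y = B x y + B x' y" for x x' y
    by (simp add: simps)
  show scale: "B (scale c x) y = c * B x y" for c x y
    by (simp add: simps)
  show "B x (y + y') = B x y + B x y'" for x y y'
    by (simp add: simps)
  show "B x (scale c y) = c * B x y" for x c y
    by (simp add: simps)
  show "B x one = B one x" for x
    by (simp add: vidinli_form_one)
  have "polar q one one = q (scale 2 one) - 2"
    using scale_left_distrib[of 1 1 one] by (simp add: polar_def norm_one)
  then show "B one one = 1"
    using two by (simp add: vidinli_form_one q_scale norm_one)
  fix x y
  have "mul (x + y) (x + y) - scale (polar q (x + y) one) (x + y) + scale (q (x + y)) one -
      (mul x x - scale (polar q x one) x + scale (q x) one) -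
      (mul y y - scale (polar q y one) y + scale (q y) one) = 0"
    by (simp add: conic)
  moreover have "scale (q (x + y)) one = scale (polar q x y) one + scale (q x) one + scale (q y) one"
    by (simp add: polar_def flip: scale_left_distrib)
  ultimately have "mul x y + mul y x =
      scale (polar q x one) y + scale (polar q y one) x - scale (polar q x y) one"
    by (simp add: mul_add_left mul_add_right polar_add_left algebra_simps)
  moreover have "mul x y + mul x y = (mul x y + mul y x) + (mul x y - mul y x)" by simp
  ultimately have "mul x y + mul x y = scale (polar q x one) y + scale (polar q y one) x -
      scale (polar q x y) one + scale (omega x y) one"
    by (simp only: commutator_omega)
  moreover have "mul x y = scale (1 / 2) (mul x y + mul x y)"
  proof -
    have "mul x y + mul x y = scale 2 (mul x y)"
      using scale_left_distrib[of 1 1 "mul x y"] by simp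
    then show ?thesis using two by simp
  qed
  ultimately have "mul x y = scale (1 / 2) (scale (polar q x one) y + scale (polar q y one) x -
      scale (polar q x y) one + scale (omega x y) one)" by metis
  then show "mul x y = scale (B one x) y + scale (B one y) x - scale (B x y) one"
    by (simp add: vidinli_form_one vidinli_form_def[of _ _ _ _ x y] scale_right_distrib
      scale_right_diff_distrib scale_left_diff_distrib diff_divide_distrib)
qed

lemma polar_eq_if_symmetric:
  assumes two: "(2 :: 'a) \<noteq> 0" and sym: "symmetric_form B"
  shows "polar q x = (\<lambda>y. 2 * B x y)"
proof
  fix y
  have "B x y + B y x = polar q x y"
    using two omega_swap[of x y] by (simp add: vidinli_form_def polar_commute[of y] field_simps)
  moreover have "B y x = B x y" using sym by (auto simp: symmetric_form_def)
  ultimately show "polar q x y = 2 * B x y" by simp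
qed

end

theorem theorem3p13:
  fixes scale :: "'f::field \<Rightarrow> 'a::ab_group_add \<Rightarrow> 'a"
    and mul :: "'a \<Rightarrow> 'a \<Rightarrow> 'a" and one :: 'a and q :: "'a \<Rightarrow> 'f"
    and B :: "'a \<Rightarrow> 'a \<Rightarrow> 'f" and V R :: "'a set"
    and M :: "('a \<Rightarrow> 'a) set" and BB :: "('a \<Rightarrow> 'f) set"
  assumes vidinli: "vidinli_algebra scale mul one q"
    and char: "CHAR('f) \<noteq> 2"
    and B: "B = vidinli_form scale mul one q"
    and V: "V = {x. polar q x one = 0}"
    and R: "R = form_radical B"
    and M: "M = mult_algebra scale mul"
    and BB: "BB = range (\<lambda>a. B a) + range (\<lambda>a y. B y a)"
  shows
    \<comment> \<open>(a)\<close>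
    "M \<subseteq> line (fscale scale) id + rank1_span scale UNIV BB
    \<comment> \<open>(b)\<close>
    \<and> End_ideal scale M (rank1_span scale R BB)
    \<and> (\<forall>\<phi>\<in>rank1_span scale R BB. \<forall>\<psi>\<in>rank1_span scale R BB. \<phi> \<circ> \<psi> = 0)
    \<comment> \<open>(c)\<close>
    \<and> ((\<exists>S. finite S \<and> module.span scale S = UNIV) \<longrightarrow>
         rank1_span scale UNIV BB = {\<phi> \<in> End_space scale. \<forall>r\<in>R. \<phi> r = 0})
    \<comment> \<open>(d)\<close>
    \<and> (symmetric_form B \<and> quotient_dim scale R \<ge> 3 \<or> \<not> symmetric_form B \<longrightarrow>
         M = line (fscale scale) id + rank1_span scale UNIV BB)
    \<comment> \<open>(e)\<close>
    \<and> (symmetric_form B \<and> quotient_dim scale R = 1 \<longrightarrow>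
         direct_sum M (line (fscale scale) id) (rank1_span scale R (range (\<lambda>a. B a))) \<and>
         direct_sum M (line (fscale scale) id) (rank1_span scale R {B one}))
    \<comment> \<open>(f)\<close>
    \<and> (symmetric_form B \<and> quotient_dim scale R = 2 \<longrightarrow>
         (\<exists>x\<in>V. direct_sum3 UNIV (line scale one) (line scale x) R) \<and>
         (\<forall>x\<in>V. direct_sum3 UNIV (line scale one) (line scale x) R \<longrightarrow>
            (let \<pi> = proj_along (line scale one + line scale x) R;
                 \<sigma> = rank1 scale x (polar q one) - rank1 scale one (polar q x)
             in Vector_Spaces.linear scale scale \<pi> \<and> \<pi> one = one \<and> \<pi> x = x \<and> (\<forall>r\<in>R. \<pi> r = 0) \<and>
                direct_sum M
                  (line (fscale scale) id + line (fscale scale) \<sigma> + line (fscale scale) \<pi>)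
                  (rank1_span scale R (range (\<lambda>a. B a))))))"
proof -
  have two: "(2 :: 'f) \<noteq> 0" using char by (rule two_neq_zero_if_CHAR_neq_2)
  interpret A: vidinli_algebra scale mul one q by (rule vidinli)
  interpret F: form_algebra scale B mul one
    unfolding B by (rule A.form_algebra_vidinli_form[OF two])
  have V: "V = {x. B one x = 0}"
    using two by (auto simp: V B A.vidinli_form_one)
  note plane = F.mult_algebra_direct_sum3[OF _ two]
  show ?thesis
    unfolding M R BB
  proof (intro conjI impI)
    show "mult_algebra scale mul \<subseteq> line (fscale scale) id + rank1_span scale UNIV F.W"
      by (rule F.mult_algebra_subset)
    show "End_ideal scale F.M (rank1_span scale F.R F.W)"
      by (rule F.rank1_span_R_ideal)
    show "\<forall>\<phi>\<in>rank1_span scale F.R F.W. \<forall>\<psi>\<in>rank1_span scale F.R F.W. \<phi> \<circ> \<psi> = 0"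
      using F.rank1_span_R_square_zero by blast
    show "rank1_span scale UNIV F.W = {\<phi> \<in> End_space scale. \<forall>r\<in>F.R. \<phi> r = 0}"
      if "\<exists>S. finite S \<and> module.span scale S = UNIV"
      using that F.rank1_span_eq_annihilator by blast
    show "F.M = line (fscale scale) id + rank1_span scale UNIV F.W"
      if "symmetric_form B \<and> 3 \<le> quotient_dim scale F.R \<or> \<not> symmetric_form B"
      using that F.mult_algebra_symmetric_large[OF _ two] F.mult_algebra_not_symmetric by blast
  next
    assume asm: "symmetric_form B \<and> quotient_dim scale F.R = 1"
    note scalars = F.mult_algebra_scalars[OF _ _ two] F.W_symmetric
    show "direct_sum F.M (line (fscale scale) id) (rank1_span scale F.R (range (\<lambda>a. B a)))"
      "direct_sum F.M (line (fscale scale) id) (rank1_span scale F.R {B one})"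
      using asm scalars by simp_all
  next
    assume asm: "symmetric_form B \<and> quotient_dim scale F.R = 2"
    show "\<exists>x\<in>V. direct_sum3 UNIV (line scale one) (line scale x) F.R"
      using asm F.ex_plane[OF _ two] by (auto simp: V)
    have polar: "polar q x = (\<lambda>y. 2 * B x y)" for x
      using A.polar_eq_if_symmetric[OF two] asm by (simp add: B)
    have W: "F.W = range (\<lambda>a. B a)" using F.W_symmetric asm by blast
    show "\<forall>x\<in>V. direct_sum3 UNIV (line scale one) (line scale x) F.R \<longrightarrow>
            (let \<pi> = proj_along (line scale one + line scale x) F.R;
                 \<sigma> = rank1 scale x (polar q one) - rank1 scale one (polar q x)
             in Vector_Spaces.linear scale scale \<pi> \<and> \<pi> one = one \<and> \<pi> x = x \<and> (\<forall>r\<in>F.R. \<pi> r = 0) \<and>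
                direct_sum F.M
                  (line (fscale scale) id + line (fscale scale) \<sigma> + line (fscale scale) \<pi>)
                  (rank1_span scale F.R (range (\<lambda>a. B a))))"
      unfolding Let_def polar
    proof (intro ballI impI conjI)
      fix x assume "x \<in> V" and sum: "direct_sum3 UNIV (line scale one) (line scale x) F.R"
      then have "B one x = 0" by (simp add: V)
      note plane[OF conjunct1[OF asm] conjunct2[OF asm] this sum, unfolded W]
      then show "Vector_Spaces.linear scale scale (proj_along (line scale one + line scale x) F.R)"
        "proj_along (line scale one + line scale x) F.R one = one"
        "proj_along (line scale one + line scale x) F.R x = x"
        "\<And>r. r \<in> F.R \<Longrightarrow> proj_along (line scale one + line scale x) F.R r = 0"
        "direct_sum F.M (line (fscale scale) id +
            line (fscale scale) (rank1 scale x (\<lambda>y. 2 * B one y) - rank1 scale one (\<lambda>y. 2 * B x y)) +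
            line (fscale scale) (proj_along (line scale one + line scale x) F.R))
          (rank1_span scale F.R (range (\<lambda>a. B a)))"
        by blast+
    qed
  qed
qed

end
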